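(* Consider the networked system $x(t+1)=(A+BQC)x(t)+BRu(t)$, $y(t)=SCx(t)$ described in the context, and assume that the matrix $S$ has full column rank. The topology of this system is identifiable if and only if $$\operatorname{cker}\left(G_i(z)\otimes H_Q^\top(z)\right)=\{0\}\quad\text{for all } i\in\{1,2,\dots,N\},$$ where $G_i(z):=C_i(zI-A_i)^{-1}B_i$, $G(z):=C(zI-A)^{-1}B$, and $H_Q(z):=\left(I-G(z)Q\right)^{-1}G(z)R$.
   Context: Network model. Let $N\ge 1$. For $i\in\mathcal V:=\{1,2,\dots,N\}$, let $A_i\in\mathbb R^{n_i\times n_i}$, $B_i\in\mathbb R^{n_i\times m_i}$, $C_i\in\mathbb R^{p_i\times n_i}$ define the discrete-time node system $x_i(t+1)=A_ix_i(t)+B_iv_i(t)$, $w_i(t)=C_ix_i(t)$. The nodes are coupled by $v_i(t)=\sum_{j=1}^N Q_{ij}w_j(t)+R_iu(t)$ with external input $u(t)\in\mathbb R^m$, and the external output is $y(t)=\sum_{i=1}^N S_iw_i(t)\in\mathbb R^p$, where $Q_{ij}\in\mathbb R^{m_i\times p_j}$, $R_i\in\mathbb R^{m_i\times m}$, $S_i\in\mathbb R^{p\times p_i}$. Let $A,B,C$ be the block diagonal matrices with diagonal blocks $A_i$, $B_i$, $C_i$ ($i=1,\dots,N$), respectively; let $Q=(Q_{ij})$ be the block matrix with blocks $Q_{ij}$ (the interconnection matrix), let $R$ be the matrix obtained by stacking $R_1,\dots,R_N$ on top of each other, and $S=\begin{pmatrix}S_1&\cdots&S_N\end{pmatrix}$.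 With $n=\sum_i n_i$ and $x(t)\in\mathbb R^n$ the stacked state, the network is $x(t+1)=(A+BQC)x(t)+BRu(t)$, $y(t)=SCx(t)$, $t=0,1,2,\dots$. The matrices $A,B,C,R,S$ are fixed and known. Identifiability. Let $y_{u,x_0,Q}(\cdot)$ denote the output of the network for input $u(\cdot)$, initial condition $x(0)=x_0$ and interconnection matrix $Q$. Two real interconnection matrices $Q,\bar Q$ (of the same size) are indistinguishable if there exist $x_0,\bar x_0\in\mathbb R^n$ such that $y_{u,x_0,Q}(\cdot)=y_{u,\bar x_0,\bar Q}(\cdot)$ for all input functions $u$; otherwise they are distinguishable. The topology of the network with interconnection matrix $Q$ is identifiable if $Q$ and $\bar Q$ are distinguishable for all real $\bar Q\neq Q$. Other notation. $\otimes$ is the Kronecker product. For a rational matrix $M(z)$ with $k$ columns, its constant kernel is $\operatorname{cker}M(z):=\{w\in\mathbb R^k\mid M(z)w=0\}$. The inverse of $I-G(z)Q$ exists as a rational matrix since $G(z)$ is strictly proper. *)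

theory Defs
  imports
    "Jordan_Normal_Form.Matrix"
    "Jordan_Normal_Form.Gauss_Jordan_Elimination"
    "Jordan_Normal_Form.DL_Rank"
    "HOL-Computational_Algebra.Normalized_Fraction"
begin

section \<open>Block matrices\<close>

text \<open>The blocks are indexed by the nodes \<open>1, \<dots>, N\<close>, and their sizes may differ from node to node.
  The explicit number of rows (columns) in \<open>block_row\<close> (\<open>block_col\<close>) is needed because the
  empty concatenation does not determine it.\<close>

definition block_diag :: "nat \<Rightarrow> (nat \<Rightarrow> 'a :: zero mat) \<Rightarrow> 'a mat" where
  "block_diag N X = diag_block_mat (map X [1..<Suc N])"

definition append_cols :: "'a :: zero mat \<Rightarrow> 'a mat \<Rightarrow> 'a mat" where
  "append_cols X Y = four_block_mat X Y (0\<^sub>m 0 (dim_col X)) (0\<^sub>m 0 (dim_col Y))"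

definition block_row :: "nat \<Rightarrow> nat \<Rightarrow> (nat \<Rightarrow> 'a :: zero mat) \<Rightarrow> 'a mat" where
  "block_row nr N X = foldr append_cols (map X [1..<Suc N]) (0\<^sub>m nr 0)"

definition block_col :: "nat \<Rightarrow> nat \<Rightarrow> (nat \<Rightarrow> 'a :: zero mat) \<Rightarrow> 'a mat" where
  "block_col nc N X = foldr append_rows (map X [1..<Suc N]) (0\<^sub>m 0 nc)"

text \<open>\<open>r i\<close> is the number of rows of the blocks in block row \<open>i\<close>, and \<open>c j\<close> the number of columns
  of the blocks in block column \<open>j\<close>.\<close>

definition block_matrix ::
  "(nat \<Rightarrow> nat) \<Rightarrow> (nat \<Rightarrow> nat) \<Rightarrow> nat \<Rightarrow> (nat \<Rightarrow> nat \<Rightarrow> 'a :: zero mat) \<Rightarrow> 'a mat" where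
  "block_matrix r c N X = block_col (\<Sum>j = 1..N. c j) N (\<lambda>i. block_row (r i) N (X i))"

definition kronecker :: "'a :: semiring_1 mat \<Rightarrow> 'a mat \<Rightarrow> 'a mat" (infixl \<open>\<otimes>\<^sub>K\<close> 70) where
  "X \<otimes>\<^sub>K Y = mat (dim_row X * dim_row Y) (dim_col X * dim_col Y)
     (\<lambda>(i, j). X $$ (i div dim_row Y, j div dim_col Y) * Y $$ (i mod dim_row Y, j mod dim_col Y))"

definition full_column_rank :: "'a :: field mat \<Rightarrow> bool" where
  "full_column_rank X \<longleftrightarrow> vec_space.rank (dim_row X) X = dim_col X"


section \<open>The network and the identifiability of its topology\<close>

primrec net_state ::
  "real mat \<Rightarrow> real mat \<Rightarrow> real mat \<Rightarrow> real mat \<Rightarrow> real mat \<Rightarrow>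
    (nat \<Rightarrow> real vec) \<Rightarrow> real vec \<Rightarrow> nat \<Rightarrow> real vec" where
  "net_state A B C R Q u x0 0 = x0"
| "net_state A B C R Q u x0 (Suc t) =
     (A + B * Q * C) *\<^sub>v net_state A B C R Q u x0 t + (B * R) *\<^sub>v u t"

definition net_output ::
  "real mat \<Rightarrow> real mat \<Rightarrow> real mat \<Rightarrow> real mat \<Rightarrow> real mat \<Rightarrow> real mat \<Rightarrow>
    (nat \<Rightarrow> real vec) \<Rightarrow> real vec \<Rightarrow> nat \<Rightarrow> real vec" where
  "net_output A B C R S Q u x0 t = (S * C) *\<^sub>v net_state A B C R Q u x0 t"

definition indistinguishable ::
  "real mat \<Rightarrow> real mat \<Rightarrow> real mat \<Rightarrow> real mat \<Rightarrow> real mat \<Rightarrow> real mat \<Rightarrow> real mat \<Rightarrow> bool" where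
  "indistinguishable A B C R S Q Q' \<longleftrightarrow>
    (\<exists>x0 \<in> carrier_vec (dim_row A). \<exists>x0' \<in> carrier_vec (dim_row A).
      \<forall>u. (\<forall>t. u t \<in> carrier_vec (dim_col R)) \<longrightarrow>
        net_output A B C R S Q u x0 = net_output A B C R S Q' u x0')"

definition distinguishable ::
  "real mat \<Rightarrow> real mat \<Rightarrow> real mat \<Rightarrow> real mat \<Rightarrow> real mat \<Rightarrow> real mat \<Rightarrow> real mat \<Rightarrow> bool" where
  "distinguishable A B C R S Q Q' \<longleftrightarrow> \<not> indistinguishable A B C R S Q Q'"

definition topology_identifiable ::
  "real mat \<Rightarrow> real mat \<Rightarrow> real mat \<Rightarrow> real mat \<Rightarrow> real mat \<Rightarrow> real mat \<Rightarrow> bool" where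
  "topology_identifiable A B C R S Q \<longleftrightarrow>
    (\<forall>Q' \<in> carrier_mat (dim_row Q) (dim_col Q). Q' \<noteq> Q \<longrightarrow> distinguishable A B C R S Q Q')"


section \<open>Rational matrices\<close>

text \<open>Rational functions in \<open>z\<close> are the elements of the fraction field of the real polynomials.\<close>

type_synonym ratfun = "real poly fract"

definition rf_const :: "real \<Rightarrow> ratfun" where
  "rf_const c = to_fract [:c:]"

definition rf_z :: ratfun where
  "rf_z = to_fract [:0, 1:]"

abbreviation rf_mat :: "real mat \<Rightarrow> ratfun mat" where
  "rf_mat \<equiv> map_mat rf_const"

text \<open>Unspecified when \<open>M\<close> is not invertible. It is only applied to \<open>zI - A\<close> and to \<open>I - G(z)Q\<close>, which
  are invertible over the field of rational functions.\<close>

definition rf_inv :: "ratfun mat \<Rightarrow> ratfun mat" where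
  "rf_inv M = the (mat_inverse M)"

definition transfer_matrix :: "real mat \<Rightarrow> real mat \<Rightarrow> real mat \<Rightarrow> ratfun mat" where
  "transfer_matrix A B C =
     rf_mat C * rf_inv (rf_z \<cdot>\<^sub>m 1\<^sub>m (dim_row A) - rf_mat A) * rf_mat B"

definition network_H :: "real mat \<Rightarrow> real mat \<Rightarrow> real mat \<Rightarrow> real mat \<Rightarrow> real mat \<Rightarrow> ratfun mat" where
  "network_H A B C R Q =
     (let G = transfer_matrix A B C
      in rf_inv (1\<^sub>m (dim_row G) - G * rf_mat Q) * G * rf_mat R)"

definition cker :: "ratfun mat \<Rightarrow> real vec set" where
  "cker M = {w \<in> carrier_vec (dim_col M). M *\<^sub>v map_vec rf_const w = 0\<^sub>v (dim_row M)}"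

end

theory Submission
  imports Defs
begin

text \<open>
  Write \<open>F = A + BQC\<close> for the state matrix of the network. Because the network is linear,
  subtracting the response to the zero input removes the initial conditions, so \<open>Q\<close> and \<open>Q'\<close>
  are indistinguishable exactly when their impulse responses agree; as \<open>S\<close> is injective, it can be
  stripped off, and what remains is \<open>C F\<^sup>k B R = C F'\<^sup>k B R\<close> for all \<open>k\<close>
  (lemma \<open>indistinguishable_iff_markov_eq\<close>). These Markov parameters are the
  coefficients of the expansion at infinity of \<open>C (zI - F)\<^sup>-\<^sup>1 B R\<close>, which equals \<open>H\<^sub>Q\<close>
  (lemma \<open>network_H_eq_transfer_matrix\<close>); hence indistinguishability means \<open>H\<^sub>Q = H\<^sub>Q\<^sub>'\<close>
  (lemma \<open>transfer_matrix_eq_iff_markov_eq\<close>). From \<open>(I - G Q) H\<^sub>Q = G R = (I - G Q') H\<^sub>Q\<^sub>'\<close> one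
  reads off that this is in turn equivalent to \<open>G (Q' - Q) H\<^sub>Q = 0\<close> (lemma \<open>network_H_eq_iff\<close>),
  a condition that is linear in the unknown \<open>\<Delta> = Q' - Q\<close>. So the topology is identifiable iff the
  real linear map \<open>\<Delta> \<mapsto> G \<Delta> H\<^sub>Q\<close> is injective.

  As \<open>G\<close> is block diagonal, this map acts separately on the block rows \<open>\<Delta>\<^sub>i\<close> of \<open>\<Delta>\<close>, as
  \<open>\<Delta>\<^sub>i \<mapsto> G\<^sub>i \<Delta>\<^sub>i H\<^sub>Q\<close> (lemma \<open>sandwich_injective_diag_block_mat\<close>), and listing the entries of \<open>\<Delta>\<^sub>i\<close>
  row by row turns the latter map into multiplication by \<open>G\<^sub>i \<otimes> H\<^sub>Q\<^sup>T\<close>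
  (lemma \<open>cker_kronecker_trivial_iff\<close>).

  Expansions at infinity are replaced by degree bounds: a rational function of degree at most
  \<open>k\<close> for every integer \<open>k\<close> is zero. The descent argument that this permits yields the
  invertibility of \<open>zI - F\<close> and of \<open>I - G Q\<close>, the strict properness of resolvents and the
  determination of a transfer matrix by its Markov parameters.
\<close>

section \<open>The degree of a rational function\<close>

text \<open>The degree of a nonzero fraction \<open>a / b\<close> is \<open>deg a - deg b\<close>, an integer, and that of \<open>0\<close> is minus
  infinity. Only upper bounds for it are ever used, and stating them as a predicate avoids both the
  infinite value and the choice of a representative. The bound \<open>-1\<close> is strict properness.\<close>

definition rf_deg_le :: "int \<Rightarrow> ratfun \<Rightarrow> bool" where
  "rf_deg_le k f \<longleftrightarrow>
    (\<exists>a b. b \<noteq> 0 \<and> f = Fract a b \<and> (a = 0 \<or> int (degree a) \<le> int (degree b) + k))"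

lemma rf_deg_leI:
  "b \<noteq> 0 \<Longrightarrow> f = Fract a b \<Longrightarrow> a = 0 \<or> int (degree a) \<le> int (degree b) + k \<Longrightarrow> rf_deg_le k f"
  unfolding rf_deg_le_def by blast

lemma rf_deg_le_zero [simp]: "rf_deg_le k 0"
  by (rule rf_deg_leI[of 1 _ 0]) (auto simp: Zero_fract_def)

lemma rf_deg_le_mono: "rf_deg_le k f \<Longrightarrow> k \<le> l \<Longrightarrow> rf_deg_le l f"
  unfolding rf_deg_le_def by force

lemma rf_deg_le_mult:
  assumes "rf_deg_le k f" "rf_deg_le l g" shows "rf_deg_le (k + l) (f * g)"
proof -
  obtain a b where f: "b \<noteq> 0" "f = Fract a b" "a = 0 \<or> int (degree a) \<le> int (degree b) + k"
    using assms(1) unfolding rf_deg_le_def by blast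
  obtain c d where g: "d \<noteq> 0" "g = Fract c d" "c = 0 \<or> int (degree c) \<le> int (degree d) + l"
    using assms(2) unfolding rf_deg_le_def by blast
  show ?thesis
  proof (rule rf_deg_leI[of "b * d" _ "a * c"])
    show "a * c = 0 \<or> int (degree (a * c)) \<le> int (degree (b * d)) + (k + l)"
      using f(1,3) g(1,3) by (cases "a = 0 \<or> c = 0") (auto simp: degree_mult_eq)
  qed (use f g in auto)
qed

lemma rf_deg_le_add:
  assumes "rf_deg_le k f" "rf_deg_le k g" shows "rf_deg_le k (f + g)"
proof -
  obtain a b where f: "b \<noteq> 0" "f = Fract a b" "a = 0 \<or> int (degree a) \<le> int (degree b) + k"
    using assms(1) unfolding rf_deg_le_def by blast
  obtain c d where g: "d \<noteq> 0" "g = Fract c d" "c = 0 \<or> int (degree c) \<le> int (degree d) + k"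
    using assms(2) unfolding rf_deg_le_def by blast
  have sum_bound: "p + q = 0 \<or> int (degree (p + q)) \<le> K"
    if "p = 0 \<or> int (degree p) \<le> K" "q = 0 \<or> int (degree q) \<le> K" for p q :: "real poly" and K
  proof (cases "p = 0 \<or> q = 0")
    case True then show ?thesis using that by auto
  next
    case False
    then show ?thesis using that degree_add_le_max[of p q] by auto
  qed
  show ?thesis
  proof (rule rf_deg_leI[of "b * d" _ "a * d + c * b"])
    show "a * d + c * b = 0 \<or> int (degree (a * d + c * b)) \<le> int (degree (b * d)) + k"
    proof (rule sum_bound)
      show "a * d = 0 \<or> int (degree (a * d)) \<le> int (degree (b * d)) + k"
        using f(1,3) g(1) by (cases "a = 0") (auto simp: degree_mult_eq)
      show "c * b = 0 \<or> int (degree (c * b)) \<le> int (degree (b * d)) + k"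
        using f(1) g(1,3) by (cases "c = 0") (auto simp: degree_mult_eq)
    qed
  qed (use f g in auto)
qed

lemma rf_deg_le_uminus: "rf_deg_le k f \<Longrightarrow> rf_deg_le k (- f)"
  unfolding rf_deg_le_def by (metis degree_minus minus_fract neg_equal_0_iff_equal)

lemma rf_deg_le_diff: "rf_deg_le k f \<Longrightarrow> rf_deg_le k g \<Longrightarrow> rf_deg_le k (f - g)"
  using rf_deg_le_add[of k f "- g"] rf_deg_le_uminus by simp

lemma rf_deg_le_sum: "(\<And>x. x \<in> X \<Longrightarrow> rf_deg_le k (f x)) \<Longrightarrow> rf_deg_le k (sum f X)"
  by (induction X rule: infinite_finite_induct) (auto intro: rf_deg_le_add)

lemma ex_rf_deg_le: "\<exists>k. rf_deg_le k f"
proof (cases f)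
  case (Fract a b)
  then show ?thesis
    by (intro exI[of _ "int (degree a) - int (degree b)"] rf_deg_leI[of b _ a]) auto
qed

text \<open>This stands in for the uniqueness of expansions at infinity: it is what turns an unbounded descent
  of degrees into a vanishing statement.\<close>

lemma rf_deg_le_all_imp_zero:
  assumes "\<And>k. rf_deg_le (- int k) f" shows "f = 0"
proof (rule ccontr)
  assume "f \<noteq> 0"
  then obtain a b where f: "f = Fract a b" "b \<noteq> 0" "a \<noteq> 0"
    by (cases f rule: Fract_cases_nonzero) auto
  obtain c d where g: "d \<noteq> 0" "f = Fract c d"
    "c = 0 \<or> int (degree c) \<le> int (degree d) - int (Suc (degree b))"
    using assms[of "Suc (degree b)"] unfolding rf_deg_le_def by auto
  have eq: "a * d = c * b" using f g by (simp add: eq_fract)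
  then have "c \<noteq> 0" using f g by auto
  then have "degree a + degree d = degree c + degree b"
    using arg_cong[OF eq, of degree] f g by (simp add: degree_mult_eq)
  then show False using g(3) \<open>c \<noteq> 0\<close> by simp
qed

interpretation rf_const: field_hom rf_const
proof
  fix x y
  show "rf_const (x + y) = rf_const x + rf_const y"
   by (simp add: rf_const_def flip: to_fract_add)
  show "rf_const (x * y) = rf_const x * rf_const y"
   by (simp add: rf_const_def mult.commute flip: to_fract_mult)
qed (auto simp: rf_const_def pCons_one)

lemma rf_deg_le_const: "rf_deg_le 0 (rf_const c)"
  by (rule rf_deg_leI[of 1 _ "[:c:]"]) (auto simp: rf_const_def to_fract_def)

lemma rf_deg_le_const_neg_imp_zero:
  assumes "rf_deg_le (-1) (rf_const c)" shows "c = 0"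
proof -
  obtain a b where ab: "b \<noteq> 0" "rf_const c = Fract a b"
    "a = 0 \<or> int (degree a) \<le> int (degree b) + - 1"
    using assms unfolding rf_deg_le_def by blast
  have eq: "a = Polynomial.smult c b" using ab(1,2) by (auto simp: rf_const_def to_fract_def eq_fract)
  show ?thesis using ab(1,3) unfolding eq by (cases "c = 0") auto
qed

lemma rf_deg_le_z: "rf_deg_le 1 rf_z"
  by (rule rf_deg_leI[of 1 _ "[:0, 1:]"]) (auto simp: rf_z_def to_fract_def)

lemma rf_deg_le_z_mult_iff: "rf_deg_le k (rf_z * f) \<longleftrightarrow> rf_deg_le (k - 1) f"
proof
  have inv: "rf_deg_le (-1) (inverse rf_z)"
    by (rule rf_deg_leI[of "[:0, 1:]" _ 1]) (auto simp: rf_z_def to_fract_def)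
  have nz: "rf_z \<noteq> 0" by (auto simp: rf_z_def)
  assume "rf_deg_le k (rf_z * f)"
  from rf_deg_le_mult[OF inv this] show "rf_deg_le (k - 1) f"
    using nz by (simp add: mult.assoc[symmetric])
next
  assume "rf_deg_le (k - 1) f"
  from rf_deg_le_mult[OF rf_deg_le_z this] show "rf_deg_le k (rf_z * f)" by simp
qed

text \<open>Up to a power of \<open>z\<close>, the function \<open>g k\<close> is what remains of the expansion of \<open>g 0\<close> at infinity after its
  first \<open>k\<close> coefficients \<open>\<nu> 0, \<dots>, \<nu> (k - 1)\<close> have been removed. If \<open>g k\<close> vanishes, the constant
  \<open>\<nu> k\<close> is strictly proper, hence zero, and the next tail vanishes too. Conversely, if all
  coefficients vanish, then \<open>g k = z\<^sup>k g 0\<close> is strictly proper for every \<open>k\<close>, so that the degree of \<open>g 0\<close>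
  lies below every bound.\<close>

lemma strictly_proper_tails_zero_iff:
  fixes g :: "nat \<Rightarrow> ratfun" and \<nu> :: "nat \<Rightarrow> real"
  assumes sp: "\<And>k. rf_deg_le (-1) (g k)"
    and step: "\<And>k. g (Suc k) = rf_z * g k - rf_const (\<nu> k)"
  shows "g 0 = 0 \<longleftrightarrow> (\<forall>k. \<nu> k = 0)"
proof
  assume "g 0 = 0"
  have coeff: "\<nu> k = 0" if "g k = 0" for k
    using sp[of "Suc k"] rf_deg_le_uminus[of "-1" "g (Suc k)"] unfolding step that
    by (auto intro: rf_deg_le_const_neg_imp_zero)
  have "g k = 0" for k
    by (induction k) (use \<open>g 0 = 0\<close> coeff in \<open>auto simp: step\<close>)
  with coeff show "\<forall>k. \<nu> k = 0" by blast
next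
  assume \<nu>: "\<forall>k. \<nu> k = 0"
  have "rf_deg_le (- int l) (g k)" for l k
  proof (induction l arbitrary: k)
    case 0 show ?case using rf_deg_le_mono[OF sp, of 0 k] by simp
  next
    case (Suc l)
    have "rf_deg_le (- int l) (rf_z * g k)" using Suc[of "Suc k"] step \<nu> by simp
    moreover have "- int l - 1 = - int (Suc l)" by simp
    ultimately show ?case by (simp only: rf_deg_le_z_mult_iff)
  qed
  then show "g 0 = 0" by (rule rf_deg_le_all_imp_zero)
qed

section \<open>Rational matrices and resolvents\<close>

definition rf_mat_deg_le :: "int \<Rightarrow> ratfun mat \<Rightarrow> bool" where
  "rf_mat_deg_le k M \<longleftrightarrow> (\<forall>i < dim_row M. \<forall>j < dim_col M. rf_deg_le k (M $$ (i, j)))"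

lemma rf_mat_deg_leD:
  "rf_mat_deg_le k M \<Longrightarrow> i < dim_row M \<Longrightarrow> j < dim_col M \<Longrightarrow> rf_deg_le k (M $$ (i, j))"
  by (simp add: rf_mat_deg_le_def)

lemma rf_mat_deg_le_mult:
  assumes "M \<in> carrier_mat a b" "X \<in> carrier_mat b c" "rf_mat_deg_le k M" "rf_mat_deg_le l X"
  shows "rf_mat_deg_le (k + l) (M * X)"
  unfolding rf_mat_deg_le_def
proof (intro allI impI)
  fix i j assume "i < dim_row (M * X)" "j < dim_col (M * X)"
  then have ij: "i < a" "j < c" using assms by auto
  have "(M * X) $$ (i, j) = (\<Sum>s \<in> {0..<b}. M $$ (i, s) * X $$ (s, j))"
    using assms ij by (auto simp: scalar_prod_def)
  also have "rf_deg_le (k + l) \<dots>"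
    using assms ij by (intro rf_deg_le_sum rf_deg_le_mult) (auto intro: rf_mat_deg_leD)
  finally show "rf_deg_le (k + l) ((M * X) $$ (i, j))" .
qed

lemma rf_mat_deg_le_add:
  assumes "M \<in> carrier_mat a b" "X \<in> carrier_mat a b" "rf_mat_deg_le k M" "rf_mat_deg_le k X"
  shows "rf_mat_deg_le k (M + X)"
  using assms by (auto simp: rf_mat_deg_le_def intro!: rf_deg_le_add)

lemma rf_mat_deg_le_mono: "rf_mat_deg_le k M \<Longrightarrow> k \<le> l \<Longrightarrow> rf_mat_deg_le l M"
  by (auto simp: rf_mat_deg_le_def intro: rf_deg_le_mono)

lemma rf_mat_deg_le_const: "rf_mat_deg_le 0 (rf_mat M)"
  by (auto simp: rf_mat_deg_le_def rf_deg_le_const)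

lemma rf_mat_deg_le_zero: "rf_mat_deg_le k (0\<^sub>m a b)"
  by (auto simp: rf_mat_deg_le_def)

lemma ex_rf_mat_deg_le: "\<exists>k. rf_mat_deg_le k M"
proof -
  obtain d where d: "\<And>f. rf_deg_le (d f) f" using ex_rf_deg_le by metis
  let ?E = "(\<lambda>(i, j). d (M $$ (i, j))) ` ({..<dim_row M} \<times> {..<dim_col M})"
  have "rf_deg_le (Max ?E) (M $$ (i, j))" if "i < dim_row M" "j < dim_col M" for i j
    using that by (intro rf_deg_le_mono[OF d] Max_ge) (auto intro!: image_eqI[of _ _ "(i, j)"])
  then show ?thesis unfolding rf_mat_deg_le_def by blast
qed

text \<open>A matrix has finitely many entries, so some bound holds for it; the hypothesis lowers a bound one step
  at a time as long as it is at least \<open>k\<close>.\<close>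

lemma rf_mat_deg_le_descent:
  assumes "\<And>l. l \<ge> k \<Longrightarrow> rf_mat_deg_le l M \<Longrightarrow> rf_mat_deg_le (l - 1) M"
  shows "rf_mat_deg_le (k - 1) M"
proof -
  obtain l where l: "rf_mat_deg_le l M" using ex_rf_mat_deg_le by blast
  have "rf_mat_deg_le (k - 1 + int d) M \<Longrightarrow> rf_mat_deg_le (k - 1) M" for d
  proof (induction d)
    case (Suc d)
    have "rf_mat_deg_le (k - 1 + int (Suc d) - 1) M"
      by (rule assms[OF _ Suc.prems]) simp
    moreover have "k - 1 + int (Suc d) - 1 = k - 1 + int d" by simp
    ultimately show ?case using Suc.IH by (simp only:)
  qed simp
  moreover have "rf_mat_deg_le (k - 1 + int (nat (l - (k - 1)))) M"
    by (rule rf_mat_deg_le_mono[OF l]) simp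
  ultimately show ?thesis by blast
qed

lemma rf_mat_deg_le_all_imp_zero:
  assumes "\<And>k. rf_mat_deg_le k M" "M \<in> carrier_mat a b" shows "M = 0\<^sub>m a b"
  using assms by (intro eq_matI) (auto intro!: rf_deg_le_all_imp_zero rf_mat_deg_leD)

text \<open>The kernel is tested on one-column matrices, so that the degree bounds, which are stated for
  matrices, apply to its elements.\<close>

lemma det_nonzero_if_trivial_kernel:
  fixes M :: "'a::field mat"
  assumes M: "M \<in> carrier_mat n n"
    and ker: "\<And>X. X \<in> carrier_mat n 1 \<Longrightarrow> M * X = 0\<^sub>m n 1 \<Longrightarrow> X = 0\<^sub>m n 1"
  shows "det M \<noteq> 0"
proof
  assume "det M = 0"
  then obtain v where v: "v \<in> carrier_vec n" "v \<noteq> 0\<^sub>v n" "M *\<^sub>v v = 0\<^sub>v n"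
    using det_0_iff_vec_prod_zero_field[OF M] by blast
  define X where "X = mat n 1 (\<lambda>(i, _). v $ i)"
  have X: "X \<in> carrier_mat n 1" and col: "col X 0 = v" using v by (auto simp: X_def)
  have "M * X = 0\<^sub>m n 1"
  proof (rule eq_matI)
    fix i j assume "i < dim_row (0\<^sub>m n 1)" "j < dim_col (0\<^sub>m n 1)"
    then have i: "i < n" and j: "j = 0" by auto
    then show "(M * X) $$ (i, j) = 0\<^sub>m n 1 $$ (i, j)"
      using arg_cong[OF v(3), of "\<lambda>w. w $ i"] M X col by simp
  qed (use M X in auto)
  then have "X = 0\<^sub>m n 1" by (rule ker[OF X])
  then have "v = 0\<^sub>v n" using col by auto
  then show False using v by simp
qed

lemma rf_inv:
  assumes M: "M \<in> carrier_mat n n" and "det M \<noteq> 0"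
  shows "rf_inv M \<in> carrier_mat n n" "M * rf_inv M = 1\<^sub>m n" "rf_inv M * M = 1\<^sub>m n"
proof -
  obtain Y where "mat_inverse M = Some Y"
    using mat_inverse(1)[OF M, of "()"] det_non_zero_imp_unit[OF assms, of "()"] by fastforce
  then show "rf_inv M \<in> carrier_mat n n" "M * rf_inv M = 1\<^sub>m n" "rf_inv M * M = 1\<^sub>m n"
    using mat_inverse(2)[OF M] unfolding rf_inv_def by auto
qed

lemma rf_mat_deg_le_z_smult_iff:
  "rf_mat_deg_le k (rf_z \<cdot>\<^sub>m M) \<longleftrightarrow> rf_mat_deg_le (k - 1) M"
  by (auto simp: rf_mat_deg_le_def rf_deg_le_z_mult_iff)

text \<open>Multiplication by \<open>z\<close> raises the degree while the real matrix \<open>M\<close> does not, so a solution \<open>X\<close> whose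
  degree bound is still at least that of \<open>E\<close> has a degree smaller by one than that bound.
  With \<open>E = 0\<close> this makes \<open>zI - M\<close> injective, and with \<open>E = I\<close> it makes its inverse strictly proper.\<close>

lemma rf_mat_deg_le_state_equation:
  assumes M: "M \<in> carrier_mat n n" and X: "X \<in> carrier_mat n c" and E: "E \<in> carrier_mat n c"
    and eq: "rf_z \<cdot>\<^sub>m X = rf_mat M * X + E" and deg: "rf_mat_deg_le k E"
  shows "rf_mat_deg_le (k - 1) X"
proof (rule rf_mat_deg_le_descent)
  fix l assume l: "k \<le> l" and Xl: "rf_mat_deg_le l X"
  have "rf_mat_deg_le (0 + l) (rf_mat M * X)"
    using M X by (intro rf_mat_deg_le_mult rf_mat_deg_le_const Xl) auto
  then have "rf_mat_deg_le l (rf_mat M * X + E)"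
    using M X E by (intro rf_mat_deg_le_add[of _ n c] rf_mat_deg_le_mono[OF deg l]) auto
  then show "rf_mat_deg_le (l - 1) X"
    unfolding eq[symmetric] by (simp add: rf_mat_deg_le_z_smult_iff)
qed

abbreviation resolvent :: "real mat \<Rightarrow> ratfun mat" where
  "resolvent M \<equiv> rf_inv (rf_z \<cdot>\<^sub>m 1\<^sub>m (dim_row M) - rf_mat M)"

lemma z_one_minus_mult:
  assumes M: "M \<in> carrier_mat n n" and X: "X \<in> carrier_mat n c"
  shows "(rf_z \<cdot>\<^sub>m 1\<^sub>m (dim_row M) - rf_mat M) * X = rf_z \<cdot>\<^sub>m X - rf_mat M * X"
  using M X by (subst minus_mult_distrib_mat[where nr = n and n = n and nc = c]) auto

lemma mat_diff_eq_iff: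
  fixes X Y Z :: "'a::ab_group_add mat"
  assumes "X \<in> carrier_mat a b" "Y \<in> carrier_mat a b" "Z \<in> carrier_mat a b"
  shows "X - Y = Z \<longleftrightarrow> X = Y + Z"
  using assms by (auto simp: mat_eq_iff algebra_simps)

lemma resolvent:
  assumes M: "M \<in> carrier_mat n n"
  shows resolvent_carrier: "resolvent M \<in> carrier_mat n n"
    and resolvent_right_inverse: "(rf_z \<cdot>\<^sub>m 1\<^sub>m n - rf_mat M) * resolvent M = 1\<^sub>m n"
    and resolvent_left_inverse: "resolvent M * (rf_z \<cdot>\<^sub>m 1\<^sub>m n - rf_mat M) = 1\<^sub>m n"
    and resolvent_state_equation: "rf_z \<cdot>\<^sub>m resolvent M = rf_mat M * resolvent M + 1\<^sub>m n"
    and resolvent_strictly_proper: "rf_mat_deg_le (-1) (resolvent M)"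
proof -
  let ?Z = "rf_z \<cdot>\<^sub>m 1\<^sub>m (dim_row M) - rf_mat M"
  have Z: "?Z \<in> carrier_mat n n" using M by (intro minus_carrier_mat) auto
  have det: "det ?Z \<noteq> 0"
  proof (rule det_nonzero_if_trivial_kernel[OF Z])
    fix X :: "ratfun mat" assume X: "X \<in> carrier_mat n 1" "?Z * X = 0\<^sub>m n 1"
    then have eq: "rf_z \<cdot>\<^sub>m X = rf_mat M * X + 0\<^sub>m n 1"
      using M unfolding z_one_minus_mult[OF M X(1)]
      by (subst (asm) mat_diff_eq_iff[of _ n 1]) auto
    have "rf_mat_deg_le (k + 1 - 1) X" for k
      by (rule rf_mat_deg_le_state_equation[OF M X(1) _ eq rf_mat_deg_le_zero]) auto
    then show "X = 0\<^sub>m n 1" by (intro rf_mat_deg_le_all_imp_zero X) simp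
  qed
  note inv = rf_inv[OF Z det]
  have dim: "dim_row M = n" using M by simp
  show "resolvent M \<in> carrier_mat n n" by (rule inv)
  show "(rf_z \<cdot>\<^sub>m 1\<^sub>m n - rf_mat M) * resolvent M = 1\<^sub>m n" using inv(2) dim by simp
  show "resolvent M * (rf_z \<cdot>\<^sub>m 1\<^sub>m n - rf_mat M) = 1\<^sub>m n" using inv(3) dim by simp
  show eq: "rf_z \<cdot>\<^sub>m resolvent M = rf_mat M * resolvent M + 1\<^sub>m n"
    using inv(1,2) M unfolding z_one_minus_mult[OF M inv(1)]
    by (subst (asm) mat_diff_eq_iff[of _ n n]) auto
  have "rf_mat_deg_le 0 (1\<^sub>m n)"
    using rf_mat_deg_le_const[of "1\<^sub>m n"] by (simp add: rf_const.mat_hom_one)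
  from rf_mat_deg_le_state_equation[OF M inv(1) _ eq this]
  show "rf_mat_deg_le (-1) (resolvent M)" by simp
qed

section \<open>Transfer matrices and Markov parameters\<close>

lemma transfer_matrix_carrier:
  assumes "A \<in> carrier_mat n n" "B \<in> carrier_mat n q" "C \<in> carrier_mat r n"
  shows "transfer_matrix A B C \<in> carrier_mat r q"
  using assms unfolding transfer_matrix_def by auto

lemma transfer_matrix_strictly_proper:
  assumes "A \<in> carrier_mat n n" "B \<in> carrier_mat n q" "C \<in> carrier_mat r n"
  shows "rf_mat_deg_le (-1) (transfer_matrix A B C)"
proof -
  have "rf_mat_deg_le (0 + (-1)) (rf_mat C * resolvent A)"
    using assms resolvent_carrier[OF assms(1)]
    by (intro rf_mat_deg_le_mult rf_mat_deg_le_const resolvent_strictly_proper) auto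
  from rf_mat_deg_le_mult[OF _ _ this rf_mat_deg_le_const[of B], of r n q]
  have "rf_mat_deg_le (0 + (-1) + 0) (transfer_matrix A B C)"
    using assms resolvent_carrier[OF assms(1)] unfolding transfer_matrix_def by auto
  then show ?thesis by simp
qed

text \<open>Replacing \<open>c\<close> by \<open>c F\<close> strips the leading coefficient \<open>c b\<close> off the expansion at infinity and shifts
  the rest: this is \<open>F (zI - F)\<^sup>-\<^sup>1 = z (zI - F)\<^sup>-\<^sup>1 - I\<close>.\<close>

lemma transfer_matrix_shift:
  assumes F: "F \<in> carrier_mat n n" and b: "b \<in> carrier_mat n q" and c: "c \<in> carrier_mat r n"
  shows "transfer_matrix F b (c * F) = rf_z \<cdot>\<^sub>m transfer_matrix F b c - rf_mat (c * b)"
proof -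
  note Y = resolvent_carrier[OF F]
  have "rf_mat F * resolvent F = rf_z \<cdot>\<^sub>m resolvent F - 1\<^sub>m n"
    unfolding resolvent_state_equation[OF F] using F Y by (auto simp: mat_eq_iff)
  then have "rf_mat (c * F) * resolvent F = rf_z \<cdot>\<^sub>m (rf_mat c * resolvent F) - rf_mat c"
    using F Y c by (simp add: rf_const.mat_hom_mult[OF c F] assoc_mult_mat[of _ r n _ n _ n]
      mult_minus_distrib_mat[of _ r n _ n] mult_smult_distrib[of _ r n _ n])
  then show ?thesis
    using F Y c b unfolding transfer_matrix_def
    by (simp add: minus_mult_distrib_mat[of _ r n _ _ q] mult_smult_assoc_mat[of _ r n _ q]
       rf_const.mat_hom_mult[OF c b])
qed

text \<open>Each entry of the difference of the transfer matrices with output matrices \<open>c F\<^sup>k\<close> and \<open>c' F'\<^sup>k\<close> is a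
  sequence of strictly proper tails, whose coefficients are the differences of the Markov parameters.\<close>

lemma transfer_matrix_eq_iff_markov_eq:
  assumes F: "F \<in> carrier_mat n n" and b: "b \<in> carrier_mat n q" and c: "c \<in> carrier_mat r n"
    and F': "F' \<in> carrier_mat n' n'" and b': "b' \<in> carrier_mat n' q" and c': "c' \<in> carrier_mat r n'"
  shows "transfer_matrix F b c = transfer_matrix F' b' c' \<longleftrightarrow>
    (\<forall>k. c * F ^\<^sub>m k * b = c' * F' ^\<^sub>m k * b')"
proof -
  let ?T = "\<lambda>k. transfer_matrix F b (c * F ^\<^sub>m k)"
  let ?T' = "\<lambda>k. transfer_matrix F' b' (c' * F' ^\<^sub>m k)"
  have c: "c * F ^\<^sub>m k \<in> carrier_mat r n" and c': "c' * F' ^\<^sub>m k \<in> carrier_mat r n'" for k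
    using F c F' c' by (auto intro!: mult_carrier_mat pow_carrier_mat)
  note T = transfer_matrix_carrier[OF F b c] and T' = transfer_matrix_carrier[OF F' b' c']
  have step: "?T (Suc k) = rf_z \<cdot>\<^sub>m ?T k - rf_mat (c * F ^\<^sub>m k * b)"
     for k
    using transfer_matrix_shift[OF F b c[of k]] F assms(3)
    by (simp add: assoc_mult_mat[of _ r n _ n _ n])
  have step': "?T' (Suc k) = rf_z \<cdot>\<^sub>m ?T' k - rf_mat (c' * F' ^\<^sub>m k * b')" for k
    using transfer_matrix_shift[OF F' b' c'[of k]] F' assms(6)
    by (simp add: assoc_mult_mat[of _ r n' _ n' _ n'])
  have entry: "?T 0 $$ (i, j) = ?T' 0 $$ (i, j) \<longleftrightarrow>
    (\<forall>k. (c * F ^\<^sub>m k * b) $$ (i, j) = (c' * F' ^\<^sub>m k * b') $$ (i, j))"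
    if i: "i < r" and j: "j < q" for i j
  proof -
    let ?g = "\<lambda>k. ?T k $$ (i, j) - ?T' k $$ (i, j)"
    let ?\<nu> = "\<lambda>k. (c * F ^\<^sub>m k * b) $$ (i, j) - (c' * F' ^\<^sub>m k * b') $$ (i, j)"
    have "?g 0 = 0 \<longleftrightarrow> (\<forall>k. ?\<nu> k = 0)"
    proof (rule strictly_proper_tails_zero_iff)
      show "rf_deg_le (-1) (?g k)" for k
        using transfer_matrix_strictly_proper[OF F b c] transfer_matrix_strictly_proper[OF F' b' c']
          T[of k] T'[of k] i j by (intro rf_deg_le_diff rf_mat_deg_leD) auto
      show "?g (Suc k) = rf_z * ?g k - rf_const (?\<nu> k)" for k
        unfolding step step' using i j b b' T[of k] T'[of k] assms
        by (simp add: algebra_simps rf_const.hom_minus)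
    qed
    then show ?thesis by simp
  qed
  have zero: "?T 0 = transfer_matrix F b c" "?T' 0 = transfer_matrix F' b' c'"
    using assms by auto
  have "transfer_matrix F b c = transfer_matrix F' b' c' \<longleftrightarrow>
    (\<forall>i<r. \<forall>j<q. ?T 0 $$ (i, j) = ?T' 0 $$ (i, j))"
    unfolding zero[symmetric] using T[of 0] T'[of 0] by (auto simp: mat_eq_iff)
  also have "\<dots> \<longleftrightarrow> (\<forall>k. c * F ^\<^sub>m k * b = c' * F' ^\<^sub>m k * b')"
    using entry assms by (auto simp: mat_eq_iff)
  finally show ?thesis .
qed

section \<open>The network as a feedback loop\<close>

text \<open>The state \<open>X = (zI - A - BQC)\<^sup>-\<^sup>1 BR\<close> satisfies \<open>(zI - A) X = B (Q C X + R)\<close>: closing the loop amounts to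
  driving the uncoupled nodes, whose transfer matrix is \<open>G\<close>, by \<open>Q H + R\<close> with \<open>H = C X\<close>.\<close>

lemma transfer_matrix_closed_loop:
  assumes A: "A \<in> carrier_mat n n" and B: "B \<in> carrier_mat n q" and C: "C \<in> carrier_mat r n"
    and Q: "Q \<in> carrier_mat q r" and R: "R \<in> carrier_mat q e"
  defines "G \<equiv> transfer_matrix A B C"
    and "H \<equiv> transfer_matrix (A + B * Q * C) (B * R) C"
  shows "H = G * rf_mat Q * H + G * rf_mat R"
proof -
  let ?F = "A + B * Q * C"
  let ?Z = "rf_z \<cdot>\<^sub>m 1\<^sub>m n - rf_mat A"
  have F: "?F \<in> carrier_mat n n" using assms by auto
  note Y = resolvent_carrier[OF A] and YF = resolvent_carrier[OF F]
  have Z: "?Z \<in> carrier_mat n n" using A by (intro minus_carrier_mat) auto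
  \<comment> \<open>the z-transform of the impulse response of the state\<close>
  define X where "X = resolvent ?F * rf_mat (B * R)"
  have X: "X \<in> carrier_mat n e" using YF B R unfolding X_def by auto
  have H: "H = rf_mat C * X"
    unfolding H_def transfer_matrix_def X_def using C YF B R
    by (simp add: assoc_mult_mat[of _ r n _ n _ e])
  have homBQC: "rf_mat (B * Q * C) = rf_mat B * (rf_mat Q * rf_mat C)"
    using B Q C by (simp add: rf_const.mat_hom_mult[of _ n q _ n] rf_const.mat_hom_mult[of _ q r _ n]
        assoc_mult_mat[of _ n q _ r _ n])
  have homF: "rf_mat ?F = rf_mat A + rf_mat (B * Q * C)"
    using A B Q C by (auto simp: mat_eq_iff rf_const.hom_add)
  have "rf_z \<cdot>\<^sub>m X = (rf_z \<cdot>\<^sub>m resolvent ?F) * rf_mat (B * R)"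
    unfolding X_def using YF B R by (simp add: mult_smult_assoc_mat[of _ n n _ e])
  also have "\<dots> = rf_mat ?F * X + rf_mat (B * R)"
    unfolding X_def resolvent_state_equation[OF F] using F YF B R
    by (subst add_mult_distrib_mat[of _ n n _ _ e]) (auto simp: assoc_mult_mat[of _ n n _ n _ e])
  also have "\<dots> = rf_mat A * X + (rf_mat B * (rf_mat Q * H) + rf_mat B * rf_mat R)"
    unfolding homF homBQC H using A B Q C R X
    by (simp add: add_mult_distrib_mat[of _ n n _ _ e] assoc_mult_mat[of _ n q _ r _ e]
      assoc_mult_mat[of _ q r _ n _ e] assoc_mult_mat[of _ n q _ n _ e] rf_const.mat_hom_mult[OF B R]
      assoc_add_mat[of _ n e])
  finally have "?Z * X = rf_mat B * (rf_mat Q * H) + rf_mat B * rf_mat R"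
    using z_one_minus_mult[OF A X] A B Q C R X H
    by (simp add: mat_diff_eq_iff[of _ n e])
  then have "resolvent A * (?Z * X) =
      resolvent A * (rf_mat B * (rf_mat Q * H) + rf_mat B * rf_mat R)" by simp
  moreover have "resolvent A * (?Z * X) = X"
    using assoc_mult_mat[OF Y Z X] resolvent_left_inverse[OF A] X by simp
  ultimately have "H = rf_mat C * (resolvent A * (rf_mat B * (rf_mat Q * H) + rf_mat B * rf_mat R))"
    using H by simp
  also have "\<dots> = G * rf_mat Q * H + G * rf_mat R"
  proof -
    have Hc: "H \<in> carrier_mat r e" using H C X by auto
    have QH: "rf_mat Q * H \<in> carrier_mat q e" using Q Hc by auto
    have "resolvent A * (rf_mat B * (rf_mat Q * H) + rf_mat B * rf_mat R)
      = resolvent A * rf_mat B * (rf_mat Q * H) + resolvent A * rf_mat B * rf_mat R"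
      using Y B QH R by (simp add: mult_add_distrib_mat[of _ n n _ e] assoc_mult_mat[of _ n n _ q _ e])
    also have "rf_mat C * \<dots> = G * (rf_mat Q * H) + G * rf_mat R"
      using C Y B QH R unfolding G_def transfer_matrix_def
      by (simp add: mult_add_distrib_mat[of _ r n _ e] assoc_mult_mat[of _ r n _ q _ e]
          assoc_mult_mat[of _ n n _ q _ e] assoc_mult_mat[of _ r n _ n _ e] assoc_mult_mat[of _ r n _ n _ q])
    also have "G * (rf_mat Q * H) = G * rf_mat Q * H"
      using transfer_matrix_carrier[OF A B C] Q Hc unfolding G_def
      by (simp add: assoc_mult_mat[of _ r q _ r _ e])
    finally show ?thesis .
  qed
  finally show ?thesis .
qed

lemma mat_add_right_cancel:
  fixes X Y Z :: "'a::cancel_ab_semigroup_add mat"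
  assumes "X \<in> carrier_mat a b" "Y \<in> carrier_mat a b" "Z \<in> carrier_mat a b" "X + Z = Y + Z"
  shows "X = Y"
  using assms by (auto simp: mat_eq_iff)

lemma mat_add_diff_cancel_right:
  fixes X Y Z :: "'a::ab_group_add mat"
  assumes "X \<in> carrier_mat a b" "Y \<in> carrier_mat a b" "Z \<in> carrier_mat a b"
  shows "(X + Z) - (Y + Z) = X - Y"
  using assms by (auto simp: mat_eq_iff)

text \<open>Multiplication by a strictly proper matrix lowers every degree bound, so a fixed point of it
  has arbitrarily small degree.\<close>

lemma strictly_proper_feedback_unique:
  assumes M: "M \<in> carrier_mat n n" "rf_mat_deg_le (-1) M"
    and X: "X \<in> carrier_mat n c" "M * X = X"
  shows "X = 0\<^sub>m n c"
proof (rule rf_mat_deg_le_all_imp_zero[OF _ X(1)])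
  fix k
  have "rf_mat_deg_le (k + 1 - 1) X"
  proof (rule rf_mat_deg_le_descent)
    fix l assume "rf_mat_deg_le l X"
    from rf_mat_deg_le_mult[OF M(1) X(1) M(2) this] show "rf_mat_deg_le (l - 1) X"
      using X(2) by simp
  qed
  then show "rf_mat_deg_le k X" by simp
qed

lemma one_minus_strictly_proper_det:
  assumes M: "M \<in> carrier_mat n n" "rf_mat_deg_le (-1) M"
  shows "det (1\<^sub>m n - M) \<noteq> 0"
proof (rule det_nonzero_if_trivial_kernel)
  show "1\<^sub>m n - M \<in> carrier_mat n n" using M by (intro minus_carrier_mat)
  fix X :: "ratfun mat" assume X: "X \<in> carrier_mat n 1" "(1\<^sub>m n - M) * X = 0\<^sub>m n 1"
  then have "X - M * X = 0\<^sub>m n 1"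
    using minus_mult_distrib_mat[of "1\<^sub>m n" n n M X 1] M by simp
  then have "M * X = X" using M X by (subst (asm) mat_diff_eq_iff[of _ n 1]) auto
  then show "X = 0\<^sub>m n 1" by (rule strictly_proper_feedback_unique[OF M X(1)])
qed

text \<open>Since \<open>G Q\<close> is strictly proper, \<open>I - G Q\<close> is invertible, and multiplying the loop equation
  \<open>(I - G Q) H = G R\<close> by its inverse gives the formula that defines \<open>H\<^sub>Q\<close>.\<close>

lemma network_H_eq_transfer_matrix:
  assumes A: "A \<in> carrier_mat n n" and B: "B \<in> carrier_mat n q" and C: "C \<in> carrier_mat r n"
    and Q: "Q \<in> carrier_mat q r" and R: "R \<in> carrier_mat q e"
  shows "network_H A B C R Q = transfer_matrix (A + B * Q * C) (B * R) C"
proof -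
  define G where "G = transfer_matrix A B C"
  define H where "H = transfer_matrix (A + B * Q * C) (B * R) C"
  note G = transfer_matrix_carrier[OF A B C, folded G_def]
  have H: "H \<in> carrier_mat r e"
    unfolding H_def using assms by (intro transfer_matrix_carrier[of _ n]) auto
  have GQ: "G * rf_mat Q \<in> carrier_mat r r" using G Q by auto
  have "rf_mat_deg_le (-1 + 0) (G * rf_mat Q)"
    using G Q transfer_matrix_strictly_proper[OF A B C, folded G_def]
    by (intro rf_mat_deg_le_mult rf_mat_deg_le_const) auto
  then have det: "det (1\<^sub>m r - G * rf_mat Q) \<noteq> 0"
    by (intro one_minus_strictly_proper_det GQ) simp
  have I: "1\<^sub>m r - G * rf_mat Q \<in> carrier_mat r r" using GQ by (intro minus_carrier_mat)
  note inv = rf_inv[OF I det]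
  have GR: "G * rf_mat R \<in> carrier_mat r e" using G R by auto
  have "(1\<^sub>m r - G * rf_mat Q) * H = H - G * rf_mat Q * H"
    using minus_mult_distrib_mat[of "1\<^sub>m r" r r "G * rf_mat Q" H e] GQ H by simp
  also have "\<dots> = G * rf_mat R"
    using transfer_matrix_closed_loop[OF assms] GQ H GR
    by (subst mat_diff_eq_iff[of _ r e]) (auto simp: G_def H_def)
  finally have "rf_inv (1\<^sub>m r - G * rf_mat Q) * ((1\<^sub>m r - G * rf_mat Q) * H)
     = rf_inv (1\<^sub>m r - G * rf_mat Q) * (G * rf_mat R)" by simp
  then have "H = rf_inv (1\<^sub>m r - G * rf_mat Q) * (G * rf_mat R)"
    using assoc_mult_mat[OF inv(1) I H] inv(3) H by simp
  also have "\<dots> = network_H A B C R Q"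
    using assoc_mult_mat[OF inv(1) G, of "rf_mat R" e] R G
    unfolding network_H_def Let_def G_def[symmetric] by simp
  finally show ?thesis unfolding H_def ..
qed

text \<open>Both \<open>H = H\<^sub>Q\<close> and \<open>H' = H\<^sub>Q\<^sub>'\<close> solve their loop equations. If they agree, subtracting the two
  equations gives the linear condition. Under that condition \<open>H\<close> also solves the loop
  equation of \<open>Q'\<close>, whose solution is unique because \<open>G Q'\<close> is strictly proper.\<close>

lemma network_H_eq_iff:
  assumes A: "A \<in> carrier_mat n n" and B: "B \<in> carrier_mat n q" and C: "C \<in> carrier_mat r n"
    and Q: "Q \<in> carrier_mat q r" and Q': "Q' \<in> carrier_mat q r" and R: "R \<in> carrier_mat q e"
  shows "network_H A B C R Q = network_H A B C R Q' \<longleftrightarrow>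
    transfer_matrix A B C * rf_mat (Q' - Q) * network_H A B C R Q = 0\<^sub>m r e"
proof -
  define G where "G = transfer_matrix A B C"
  define H where "H = network_H A B C R Q"
  define H' where "H' = network_H A B C R Q'"
  note G = transfer_matrix_carrier[OF A B C, folded G_def]
  have H: "H \<in> carrier_mat r e"
    unfolding H_def network_H_eq_transfer_matrix[OF A B C Q R]
    using assms by (intro transfer_matrix_carrier[of _ n]) auto
  have H': "H' \<in> carrier_mat r e"
    unfolding H'_def network_H_eq_transfer_matrix[OF A B C Q' R]
    using assms by (intro transfer_matrix_carrier[of _ n]) auto
  have eq: "H = G * rf_mat Q * H + G * rf_mat R"
    using transfer_matrix_closed_loop[OF A B C Q R]
    unfolding network_H_eq_transfer_matrix[OF A B C Q R, symmetric] G_def H_def .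
  have eq': "H' = G * rf_mat Q' * H' + G * rf_mat R"
    using transfer_matrix_closed_loop[OF A B C Q' R]
    unfolding network_H_eq_transfer_matrix[OF A B C Q' R, symmetric] G_def H'_def .
  have GQ: "G * rf_mat Q \<in> carrier_mat r r" "G * rf_mat Q' \<in> carrier_mat r r"
    and GR: "G * rf_mat R \<in> carrier_mat r e"
    using G Q Q' R by auto
  have GQH: "G * rf_mat Q * H \<in> carrier_mat r e" "G * rf_mat Q' * H \<in> carrier_mat r e"
    "G * rf_mat Q' * H' \<in> carrier_mat r e"
    using GQ H H' by auto
  have "rf_mat (Q' - Q) = rf_mat Q' - rf_mat Q"
    using Q Q' by (auto simp: mat_eq_iff rf_const.hom_minus)
  then have diff: "G * rf_mat (Q' - Q) * H = G * rf_mat Q' * H - G * rf_mat Q * H"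
    using G Q Q' H GQ by (simp add: mult_minus_distrib_mat[of _ r q _ r] minus_mult_distrib_mat[of _ r r _ _ e])
  have "H = H' \<longleftrightarrow> G * rf_mat (Q' - Q) * H = 0\<^sub>m r e"
  proof
    assume "H = H'"
    then have "G * rf_mat Q * H + G * rf_mat R = G * rf_mat Q' * H + G * rf_mat R"
      using eq eq' by simp
    then have "G * rf_mat Q * H = G * rf_mat Q' * H"
      by (rule mat_add_right_cancel[OF GQH(1,2) GR])
    then show "G * rf_mat (Q' - Q) * H = 0\<^sub>m r e" unfolding diff using GQH by auto
  next
    assume "G * rf_mat (Q' - Q) * H = 0\<^sub>m r e"
    then have "G * rf_mat Q' * H = G * rf_mat Q * H"
      unfolding diff using GQH by (subst (asm) mat_diff_eq_iff[of _ r e]) auto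
    with eq have eqH: "H = G * rf_mat Q' * H + G * rf_mat R" by simp
    have "H - H' = (G * rf_mat Q' * H + G * rf_mat R) - (G * rf_mat Q' * H' + G * rf_mat R)"
      using eqH eq' by (rule arg_cong2)
    also have "\<dots> = G * rf_mat Q' * H - G * rf_mat Q' * H'"
      by (rule mat_add_diff_cancel_right[OF GQH(2,3) GR])
    finally have "H - H' = G * rf_mat Q' * H - G * rf_mat Q' * H'" .
    then have "G * rf_mat Q' * (H - H') = H - H'"
      using mult_minus_distrib_mat[OF GQ(2) H H'] by simp
    moreover have "rf_mat_deg_le (-1 + 0) (G * rf_mat Q')"
      using G Q' transfer_matrix_strictly_proper[OF A B C, folded G_def]
      by (intro rf_mat_deg_le_mult rf_mat_deg_le_const) auto
    ultimately have "H - H' = 0\<^sub>m r e"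
      using H' by (intro strictly_proper_feedback_unique[OF GQ(2)] minus_carrier_mat) auto
    then show "H = H'" using H H' by (subst (asm) mat_diff_eq_iff[of _ r e]) auto
  qed
  then show ?thesis unfolding G_def H_def H'_def .
qed

section \<open>Indistinguishability in terms of Markov parameters\<close>

text \<open>The rank is the dimension of the span of the set of columns. A repeated column makes this set
  smaller than the number of columns, so full rank forces the columns to be distinct and,
  as a family, linearly independent.\<close>

lemma full_column_rank_mult_vec_inj:
  assumes S: "S \<in> carrier_mat nr nc" and rank: "full_column_rank S"
    and v: "v \<in> carrier_vec nc" "S *\<^sub>v v = 0\<^sub>v nr"
  shows "v = 0\<^sub>v nc"
proof (rule ccontr)
  assume nz: "v \<noteq> 0\<^sub>v nc"
  interpret vec_space "TYPE('a)" nr .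
  have rk: "rank S = nc" using rank S unfolding full_column_rank_def by simp
  have "distinct (cols S)"
  proof (rule ccontr)
    assume nd: "\<not> distinct (cols S)"
    obtain T where T: "maximal T (\<lambda>T. T \<subseteq> set (cols S) \<and> lin_indpt T)"
      using maximal_exists[of "(\<lambda>T. T \<subseteq> set (cols S) \<and> lin_indpt T)" "card (set (cols S))" "{}"]
      by (meson List.finite_set card_mono empty_iff empty_subsetI finite_lin_indpt2 rev_finite_subset)
    then have "card T \<le> card (set (cols S))" by (simp add: card_mono maximal_def)
    also have "\<dots> < length (cols S)"
      using nd card_length[of "cols S"] card_distinct[of "cols S"] by linarith
    finally show False using rank_card_indpt[OF S T] rk S by simp
  qed
  then show False
    using full_rank_lin_indpt[OF S rk] lin_depI[OF S v(1) nz v(2)] by blast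
qed

lemma full_column_rank_mult_cancel:
  fixes S :: "'a::field mat"
  assumes S: "S \<in> carrier_mat nr nc" and rank: "full_column_rank S"
    and XY: "X \<in> carrier_mat nc k" "Y \<in> carrier_mat nc k" "S * X = S * Y"
  shows "X = Y"
proof -
  have "col X j = col Y j" if j: "j < k" for j
  proof -
    have c: "col X j \<in> carrier_vec nc" "col Y j \<in> carrier_vec nc" using XY by auto
    have "S *\<^sub>v col X j = S *\<^sub>v col Y j"
      using XY S j by (metis col_mult2)
    then have "S *\<^sub>v (col X j - col Y j) = 0\<^sub>v nr"
      using S c by (simp add: mult_minus_distrib_mat_vec)
    then have "col X j - col Y j = 0\<^sub>v nc"
      using full_column_rank_mult_vec_inj[OF S rank] c by simp
    then show ?thesis using c XY
      by (intro eq_vecI) (auto simp: vec_eq_iff)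
  qed
  then show ?thesis using XY by (intro mat_col_eqI) auto
qed

lemma net_state_carrier:
  assumes "A \<in> carrier_mat n n" "B \<in> carrier_mat n q" "C \<in> carrier_mat r n" "Q \<in> carrier_mat q r"
    and "R \<in> carrier_mat q e" and "x0 \<in> carrier_vec n" and "\<And>t. u t \<in> carrier_vec e"
  shows "net_state A B C R Q u x0 t \<in> carrier_vec n"
proof (induction t)
  case (Suc t)
  have "A + B * Q * C \<in> carrier_mat n n" "B * R \<in> carrier_mat n e" using assms by auto
  then show ?case using Suc assms(7) by (auto intro!: add_carrier_vec mult_mat_vec_carrier)
qed (use assms in simp)

lemma pow_mat_commutes:
  fixes M :: "'a::semiring_1 mat"
  assumes M: "M \<in> carrier_mat n n" shows "M * M ^\<^sub>m k = M ^\<^sub>m k * M"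
proof (induction k)
  case (Suc k)
  have "M * (M ^\<^sub>m k * M) = (M * M ^\<^sub>m k) * M"
    using M by (subst assoc_mult_mat[of _ n n _ n _ n]) auto
  then show ?case using Suc by simp
qed (use M in simp)

lemma col_eq_mult_unit_vec:
  fixes M :: "'a::semiring_1 mat"
  assumes "M \<in> carrier_mat a b" "j < b" shows "col M j = M *\<^sub>v unit_vec b j"
  using col_mult2[OF assms(1) one_carrier_mat assms(2)] assms by simp

lemma vec_add_left_cancel:
  fixes x y z :: "'a::cancel_ab_semigroup_add vec"
  assumes "x + y = x + z" "x \<in> carrier_vec n" "y \<in> carrier_vec n" "z \<in> carrier_vec n"
  shows "y = z"
  using assms by (auto simp: vec_eq_iff)

lemma mult_mat_zero_vec:
  fixes M :: "'a::semiring_0 mat"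
  assumes "M \<in> carrier_mat a b" shows "M *\<^sub>v 0\<^sub>v b = 0\<^sub>v a"
  using assms by (intro eq_vecI) auto

text \<open>An input that is nonzero only at time \<open>0\<close> adds its own response to the free motion of the state;
  an initial condition therefore drops out when the zero input is compared with an impulse.\<close>

lemma net_state_impulse:
  assumes A: "A \<in> carrier_mat n n" and B: "B \<in> carrier_mat n q" and C: "C \<in> carrier_mat r n"
    and Q: "Q \<in> carrier_mat q r" and R: "R \<in> carrier_mat q e"
    and x0: "x0 \<in> carrier_vec n" and v: "v \<in> carrier_vec e"
  shows "net_state A B C R Q (\<lambda>t. if t = 0 then v else 0\<^sub>v e) x0 (Suc t) =
    net_state A B C R Q (\<lambda>t. 0\<^sub>v e) x0 (Suc t) +
    (A + B * Q * C) ^\<^sub>m t *\<^sub>v ((B * R) *\<^sub>v v)"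
proof (induction t)
  case 0
  have "A + B * Q * C \<in> carrier_mat n n" "B * R \<in> carrier_mat n e" using assms by auto
  moreover from this(2) have "(B * R) *\<^sub>v 0\<^sub>v e = 0\<^sub>v n" by (rule mult_mat_zero_vec)
  ultimately have "(A + B * Q * C) *\<^sub>v x0 \<in> carrier_vec n" "(B * R) *\<^sub>v v \<in> carrier_vec n"
    and "(B * R) *\<^sub>v 0\<^sub>v e = 0\<^sub>v n" using x0 v by (auto intro!: mult_mat_vec_carrier)
  moreover have "(A + B * Q * C) ^\<^sub>m 0 = 1\<^sub>m n" using A B C Q by simp
  ultimately show ?case by simp
next
  case (Suc t)
  let ?F = "A + B * Q * C" and ?x = "net_state A B C R Q (\<lambda>t. 0\<^sub>v e) x0 (Suc t)"
  let ?b = "(B * R) *\<^sub>v v"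
  have F: "?F \<in> carrier_mat n n" and BR: "B * R \<in> carrier_mat n e" using assms by auto
  have b: "?b \<in> carrier_vec n" using BR v by (rule mult_mat_vec_carrier)
  have x: "?x \<in> carrier_vec n" by (rule net_state_carrier[OF A B C Q R x0]) simp
  have Fb: "?F ^\<^sub>m t *\<^sub>v ?b \<in> carrier_vec n"
    using pow_carrier_mat[OF F] b by (rule mult_mat_vec_carrier)
  have zero: "(B * R) *\<^sub>v 0\<^sub>v e = 0\<^sub>v n" using BR by (rule mult_mat_zero_vec)
  have pow: "?F *\<^sub>v (?F ^\<^sub>m t *\<^sub>v ?b) = ?F ^\<^sub>m Suc t *\<^sub>v ?b"
    using F b by (subst assoc_mult_mat_vec[of _ n n _ n, symmetric]) (auto simp: pow_mat_commutes[OF F])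
  have "net_state A B C R Q (\<lambda>t. if t = 0 then v else 0\<^sub>v e) x0 (Suc (Suc t)) =
      ?F *\<^sub>v (?x + ?F ^\<^sub>m t *\<^sub>v ?b) + (B * R) *\<^sub>v 0\<^sub>v e"
    by (subst net_state.simps(2), subst Suc.IH) simp
  also have "\<dots> = ?F *\<^sub>v ?x + ?F ^\<^sub>m Suc t *\<^sub>v ?b"
    unfolding mult_add_distrib_mat_vec[OF F x Fb] pow zero

    by (rule right_zero_vec[OF add_carrier_vec[OF mult_mat_vec_carrier[OF F x]
          mult_mat_vec_carrier[OF pow_carrier_mat[OF F] b]]])
  also have "?F *\<^sub>v ?x = ?F *\<^sub>v ?x + (B * R) *\<^sub>v 0\<^sub>v e"
    unfolding zero by (rule right_zero_vec[OF mult_mat_vec_carrier[OF F x], symmetric])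
  also have "\<dots> = net_state A B C R Q (\<lambda>t. 0\<^sub>v e) x0 (Suc (Suc t))"
    by (rule net_state.simps(2)[symmetric])
  finally show ?case .
qed

text \<open>Comparing the outputs for the zero input and for an impulse in one input component gives one column
  of the Markov parameters, whatever the two initial states are. Conversely, equal Markov parameters
  make the zero initial states produce equal outputs: by induction on \<open>t\<close>, all the observations
  \<open>C F\<^sup>k x(t)\<close> agree, for every \<open>k\<close> at once, because advancing time trades \<open>k\<close> for \<open>k + 1\<close>.\<close>

lemma indistinguishable_iff_markov_eq:
  assumes A: "A \<in> carrier_mat n n" and B: "B \<in> carrier_mat n q" and C: "C \<in> carrier_mat r n"
    and Q: "Q \<in> carrier_mat q r" and Q': "Q' \<in> carrier_mat q r" and R: "R \<in> carrier_mat q e"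
    and S: "S \<in> carrier_mat s r" and rank: "full_column_rank S"
  shows "indistinguishable A B C R S Q Q' \<longleftrightarrow>
    (\<forall>k. C * (A + B * Q * C) ^\<^sub>m k * (B * R) = C * (A + B * Q' * C) ^\<^sub>m k * (B * R))"
proof -
  let ?F = "A + B * Q * C" and ?F' = "A + B * Q' * C"
  have F: "?F \<in> carrier_mat n n" "?F' \<in> carrier_mat n n" and BR: "B * R \<in> carrier_mat n e"
    using assms by auto
  have CF: "C * ?F ^\<^sub>m k \<in> carrier_mat r n" "C * ?F' ^\<^sub>m k \<in> carrier_mat r n" for k
    using F C by (auto intro!: mult_carrier_mat pow_carrier_mat)
  have SC: "S * C \<in> carrier_mat s n" using S C by auto
  show ?thesis
  proof
    assume "indistinguishable A B C R S Q Q'"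
    then obtain x0 x0' where x0: "x0 \<in> carrier_vec n" "x0' \<in> carrier_vec n"
      and eq: "\<And>u t. (\<forall>t. u t \<in> carrier_vec e) \<Longrightarrow>
         net_output A B C R S Q u x0 t = net_output A B C R S Q' u x0' t"
      using A R unfolding indistinguishable_def by auto
    show "\<forall>k. C * ?F ^\<^sub>m k * (B * R) = C * ?F' ^\<^sub>m k * (B * R)"
    proof
      fix k
      have M: "C * ?F ^\<^sub>m k * (B * R) \<in> carrier_mat r e" "C * ?F' ^\<^sub>m k * (B * R) \<in> carrier_mat r e"
        using CF[of k] BR by auto
      have cols: "col (S * (C * ?F ^\<^sub>m k * (B * R))) j = col (S * (C * ?F' ^\<^sub>m k * (B * R))) j"
        if j: "j < e" for j
      proof -
        let ?v = "unit_vec e j :: real vec"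
        let ?u = "\<lambda>t::nat. if t = 0 then ?v else 0\<^sub>v e" and ?idle = "\<lambda>t::nat. 0\<^sub>v e :: real vec"
        have col: "col (S * (C * M ^\<^sub>m k * (B * R))) j = (S * C) *\<^sub>v (M ^\<^sub>m k *\<^sub>v ((B * R) *\<^sub>v ?v))"
          if "M \<in> carrier_mat n n" for M
        proof -
          have CM: "C * M ^\<^sub>m k \<in> carrier_mat r n" and Mk: "M ^\<^sub>m k \<in> carrier_mat n n"
            using C that by (auto intro!: mult_carrier_mat pow_carrier_mat)
          have "col (S * (C * M ^\<^sub>m k * (B * R))) j = S *\<^sub>v ((C * M ^\<^sub>m k) *\<^sub>v col (B * R) j)"
            by (simp only: col_mult2[OF S mult_carrier_mat[OF CM BR] j] col_mult2[OF CM BR j])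
          also have "col (B * R) j = (B * R) *\<^sub>v ?v"
            by (rule col_eq_mult_unit_vec[OF BR j])
          also have "S *\<^sub>v ((C * M ^\<^sub>m k) *\<^sub>v ((B * R) *\<^sub>v ?v)) = (S * C) *\<^sub>v (M ^\<^sub>m k *\<^sub>v ((B * R) *\<^sub>v ?v))"
            using S C Mk BR by (simp add: assoc_mult_mat_vec[of _ r n _ n] assoc_mult_mat_vec[of _ s r _ n])
          finally show ?thesis .
        qed
        let ?f = "?F ^\<^sub>m k *\<^sub>v ((B * R) *\<^sub>v ?v)" and ?f' = "?F' ^\<^sub>m k *\<^sub>v ((B * R) *\<^sub>v ?v)"
        let ?x = "net_state A B C R Q ?idle x0 (Suc k)" and ?x' = "net_state A B C R Q' ?idle x0' (Suc k)"
        have f: "?f \<in> carrier_vec n" "?f' \<in> carrier_vec n"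
          using F BR by (auto intro!: mult_mat_vec_carrier pow_carrier_mat)
        have x: "?x \<in> carrier_vec n" "?x' \<in> carrier_vec n"
          using net_state_carrier[OF A B C Q R x0(1), of ?idle "Suc k"]
            net_state_carrier[OF A B C Q' R x0(2), of ?idle "Suc k"] by auto
        have free: "(S * C) *\<^sub>v ?x = (S * C) *\<^sub>v ?x'"
          using eq[of ?idle "Suc k"] unfolding net_output_def by simp
        have u: "\<forall>t. ?u t \<in> carrier_vec e" by auto
        have out: "net_output A B C R S Q ?u x0 (Suc k) = net_output A B C R S Q' ?u x0' (Suc k)"
          using u by (rule eq)
        have "(S * C) *\<^sub>v (?x + ?f) = (S * C) *\<^sub>v (?x' + ?f')"
          using out unfolding net_output_def
          by (simp only: net_state_impulse[OF A B C Q R x0(1) unit_vec_carrier]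
            net_state_impulse[OF A B C Q' R x0(2) unit_vec_carrier])
        then have "(S * C) *\<^sub>v ?x' + (S * C) *\<^sub>v ?f = (S * C) *\<^sub>v ?x' + (S * C) *\<^sub>v ?f'"
          unfolding mult_add_distrib_mat_vec[OF SC x(1) f(1)] mult_add_distrib_mat_vec[OF SC x(2) f(2)]
            free .
        then have "(S * C) *\<^sub>v ?f = (S * C) *\<^sub>v ?f'"
          by (rule vec_add_left_cancel[of _ _ _ s]) (use SC f x in \<open>auto intro!: mult_mat_vec_carrier\<close>)
        then show ?thesis using col F by simp
      qed
      have "S * (C * ?F ^\<^sub>m k * (B * R)) = S * (C * ?F' ^\<^sub>m k * (B * R))"
        by (rule mat_col_eqI, rule cols) (use S M in auto)
      then show "C * ?F ^\<^sub>m k * (B * R) = C * ?F' ^\<^sub>m k * (B * R)"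
        by (rule full_column_rank_mult_cancel[OF S rank M])
    qed
  next
    assume markov: "\<forall>k. C * ?F ^\<^sub>m k * (B * R) = C * ?F' ^\<^sub>m k * (B * R)"
    have "net_output A B C R S Q u (0\<^sub>v n) t = net_output A B C R S Q' u (0\<^sub>v n) t"
      if u: "\<And>t. u t \<in> carrier_vec e" for u t
    proof -
      let ?x = "net_state A B C R Q u (0\<^sub>v n)" and ?x' = "net_state A B C R Q' u (0\<^sub>v n)"
      have x: "?x t \<in> carrier_vec n" "?x' t \<in> carrier_vec n" for t
        using net_state_carrier[OF A B C Q R zero_carrier_vec u]
          net_state_carrier[OF A B C Q' R zero_carrier_vec u] by auto
      have step: "(C * M ^\<^sub>m k) *\<^sub>v (M *\<^sub>v y + (B * R) *\<^sub>v u t) =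
          (C * M ^\<^sub>m Suc k) *\<^sub>v y + (C * M ^\<^sub>m k * (B * R)) *\<^sub>v u t"
        if "M \<in> carrier_mat n n" "y \<in> carrier_vec n" for M y k t
      proof -
        have CM: "C * M ^\<^sub>m k \<in> carrier_mat r n" and Mk: "M ^\<^sub>m k \<in> carrier_mat n n"
          using C that by (auto intro!: mult_carrier_mat pow_carrier_mat)
        have "C * M ^\<^sub>m Suc k = C * M ^\<^sub>m k * M"
          using C Mk that by (simp add: assoc_mult_mat[of _ r n _ n _ n])
        then show ?thesis
          using CM that BR u[of t]
          by (simp add: mult_add_distrib_mat_vec[of _ r n] assoc_mult_mat_vec[of _ r n _ n]
              assoc_mult_mat_vec[of _ r n _ e])
      qed
      have "(C * ?F ^\<^sub>m k) *\<^sub>v ?x t = (C * ?F' ^\<^sub>m k) *\<^sub>v ?x' t" for k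
      proof (induction t arbitrary: k)
        case 0
        show ?case by (simp only: net_state.simps mult_mat_zero_vec[OF CF(1)] mult_mat_zero_vec[OF CF(2)])
      next
        case (Suc t)
        then show ?case using markov by (simp only: net_state.simps step[OF F(1) x(1)] step[OF F(2) x(2)])
      qed
      moreover have "C * ?F ^\<^sub>m 0 = C" "C * ?F' ^\<^sub>m 0 = C" using C A B by auto
      ultimately have "C *\<^sub>v ?x t = C *\<^sub>v ?x' t" by metis
      then show ?thesis
        unfolding net_output_def using S C x[of t] by (simp add: assoc_mult_mat_vec[of _ s r _ n])
    qed
    then show "indistinguishable A B C R S Q Q'"
      using A R unfolding indistinguishable_def
      by (intro bexI[of _ "0\<^sub>v n"]) auto
  qed
qed

section \<open>Identifiability as injectivity of a linear map\<close>

text \<open>The map ranges over real matrices \<open>\<Delta>\<close> only, although \<open>G\<close> and \<open>H\<close> are rational: this is the counterpart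
  of the constant kernel.\<close>

definition sandwich_injective :: "ratfun mat \<Rightarrow> ratfun mat \<Rightarrow> bool" where
  "sandwich_injective G H \<longleftrightarrow>
    (\<forall>\<Delta> \<in> carrier_mat (dim_col G) (dim_row H).
      G * rf_mat \<Delta> * H = 0\<^sub>m (dim_row G) (dim_col H) \<longrightarrow> \<Delta> = 0\<^sub>m (dim_col G) (dim_row H))"

lemma topology_identifiable_iff_sandwich_injective:
  assumes A: "A \<in> carrier_mat n n" and B: "B \<in> carrier_mat n q" and C: "C \<in> carrier_mat r n"
    and Q: "Q \<in> carrier_mat q r" and R: "R \<in> carrier_mat q e"
    and S: "S \<in> carrier_mat s r" and rank: "full_column_rank S"
  shows "topology_identifiable A B C R S Q \<longleftrightarrow>
    sandwich_injective (transfer_matrix A B C) (network_H A B C R Q)"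
proof -
  let ?G = "transfer_matrix A B C" and ?H = "network_H A B C R Q"
  have G: "?G \<in> carrier_mat r q" by (rule transfer_matrix_carrier[OF A B C])
  have H: "?H \<in> carrier_mat r e"
    unfolding network_H_eq_transfer_matrix[OF A B C Q R]
    using assms by (intro transfer_matrix_carrier[of _ n]) auto
  have "indistinguishable A B C R S Q Q' \<longleftrightarrow> ?G * rf_mat (Q' - Q) * ?H = 0\<^sub>m r e"
    if Q': "Q' \<in> carrier_mat q r" for Q'
  proof -
    have F: "A + B * Q * C \<in> carrier_mat n n" "A + B * Q' * C \<in> carrier_mat n n"
      and BR: "B * R \<in> carrier_mat n e" using assms Q' by auto
    have "indistinguishable A B C R S Q Q' \<longleftrightarrow> ?H = network_H A B C R Q'"
      unfolding indistinguishable_iff_markov_eq[OF A B C Q Q' R S rank]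
        network_H_eq_transfer_matrix[OF A B C Q R] network_H_eq_transfer_matrix[OF A B C Q' R]
        transfer_matrix_eq_iff_markov_eq[OF F(1) BR C F(2) BR C] ..
    then show ?thesis unfolding network_H_eq_iff[OF A B C Q Q' R] .
  qed
  then have "topology_identifiable A B C R S Q \<longleftrightarrow>
      (\<forall>Q' \<in> carrier_mat q r. ?G * rf_mat (Q' - Q) * ?H = 0\<^sub>m r e \<longrightarrow> Q' = Q)"
    using Q unfolding topology_identifiable_def distinguishable_def by auto
  also have "\<dots> \<longleftrightarrow> (\<forall>\<Delta> \<in> carrier_mat q r. ?G * rf_mat \<Delta> * ?H = 0\<^sub>m r e \<longrightarrow> \<Delta> = 0\<^sub>m q r)"
  proof (intro iffI ballI impI)
    fix \<Delta> assume *: "\<forall>Q' \<in> carrier_mat q r. ?G * rf_mat (Q' - Q) * ?H = 0\<^sub>m r e \<longrightarrow> Q' = Q"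
      and \<Delta>: "\<Delta> \<in> carrier_mat q r" "?G * rf_mat \<Delta> * ?H = 0\<^sub>m r e"
    have "Q + \<Delta> - Q = \<Delta>" using Q \<Delta> by (subst mat_diff_eq_iff[of _ q r]) auto
    then have "Q + \<Delta> = Q" using * \<Delta> Q by auto
    then show "\<Delta> = 0\<^sub>m q r" using \<open>Q + \<Delta> - Q = \<Delta>\<close> Q by auto
  next
    fix Q' assume *: "\<forall>\<Delta> \<in> carrier_mat q r. ?G * rf_mat \<Delta> * ?H = 0\<^sub>m r e \<longrightarrow> \<Delta> = 0\<^sub>m q r"
      and Q': "Q' \<in> carrier_mat q r" "?G * rf_mat (Q' - Q) * ?H = 0\<^sub>m r e"
    have "Q' - Q = 0\<^sub>m q r" using * Q' minus_carrier_mat[OF Q] by blast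
    then show "Q' = Q" using Q Q' by (subst (asm) mat_diff_eq_iff[of _ q r]) auto
  qed
  finally show ?thesis using G H unfolding sandwich_injective_def by simp
qed

section \<open>Block diagonal matrices\<close>

lemma diag_block_mat_Cons:
  "diag_block_mat (X # Xs) = four_block_mat X (0\<^sub>m (dim_row X) (dim_col (diag_block_mat Xs)))
     (0\<^sub>m (dim_row (diag_block_mat Xs)) (dim_col X)) (diag_block_mat Xs)"
  by (simp add: Let_def)

lemma diag_block_mat_carrier:
  assumes "\<And>i. i \<in> set is \<Longrightarrow> X i \<in> carrier_mat (r i) (c i)"
  shows "diag_block_mat (map X is) \<in> carrier_mat (sum_list (map r is)) (sum_list (map c is))"
  using assms
proof (induction "is")
  case (Cons i "is")
  then have "X i \<in> carrier_mat (r i) (c i)"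
    "diag_block_mat (map X is) \<in> carrier_mat (sum_list (map r is)) (sum_list (map c is))" by auto
  then show ?case by (auto simp: Let_def)
qed simp

abbreviation block_diag2 :: "'a::zero mat \<Rightarrow> 'a mat \<Rightarrow> 'a mat" where
  "block_diag2 X Y \<equiv> four_block_mat X (0\<^sub>m (dim_row X) (dim_col Y)) (0\<^sub>m (dim_row Y) (dim_col X)) Y"

lemma block_diag2_mult:
  fixes X1 X2 Y1 Y2 :: "'a::semiring_0 mat"
  assumes "X1 \<in> carrier_mat a1 b1" "X2 \<in> carrier_mat a2 b2"
    "Y1 \<in> carrier_mat b1 c1" "Y2 \<in> carrier_mat b2 c2"
  shows "block_diag2 X1 X2 * block_diag2 Y1 Y2 = block_diag2 (X1 * Y1) (X2 * Y2)"
proof -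
  have "block_diag2 X1 X2 * block_diag2 Y1 Y2 =
    four_block_mat (X1 * Y1 + 0\<^sub>m a1 b2 * 0\<^sub>m b2 c1) (X1 * 0\<^sub>m b1 c2 + 0\<^sub>m a1 b2 * Y2)
      (0\<^sub>m a2 b1 * Y1 + X2 * 0\<^sub>m b2 c1) (0\<^sub>m a2 b1 * 0\<^sub>m b1 c2 + X2 * Y2)"
    using assms by (subst mult_four_block_mat[of _ a1 b1 _ b2 _ a2 _ _ c1 _ c2]) auto
  also have "\<dots> = block_diag2 (X1 * Y1) (X2 * Y2)"
    using assms by (intro cong_four_block_mat) auto
  finally show ?thesis .
qed

lemma rf_mat_block_diag2: "rf_mat (block_diag2 X Y) = block_diag2 (rf_mat X) (rf_mat Y)"
  by (rule eq_matI) auto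

lemma resolvent_unique:
  assumes M: "M \<in> carrier_mat n n" and W: "W \<in> carrier_mat n n"
    and inv: "(rf_z \<cdot>\<^sub>m 1\<^sub>m n - rf_mat M) * W = 1\<^sub>m n"
  shows "resolvent M = W"
proof -
  have Z: "rf_z \<cdot>\<^sub>m 1\<^sub>m n - rf_mat M \<in> carrier_mat n n" using M by (intro minus_carrier_mat) auto
  have "resolvent M * ((rf_z \<cdot>\<^sub>m 1\<^sub>m n - rf_mat M) * W) = W"
    using assoc_mult_mat[OF resolvent_carrier[OF M] Z W] resolvent_left_inverse[OF M] W by simp
  then show ?thesis using inv resolvent_carrier[OF M] by simp
qed

text \<open>The block diagonal matrix of the two resolvents is a right inverse of \<open>zI - A\<close>, and inverses are unique.\<close>

lemma resolvent_block_diag2: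
  assumes A1: "A1 \<in> carrier_mat n1 n1" and A2: "A2 \<in> carrier_mat n2 n2"
  shows "resolvent (block_diag2 A1 A2) = block_diag2 (resolvent A1) (resolvent A2)"
proof (rule resolvent_unique)
  note Y1 = resolvent_carrier[OF A1] and Y2 = resolvent_carrier[OF A2]
  let ?Z1 = "rf_z \<cdot>\<^sub>m 1\<^sub>m n1 - rf_mat A1" and ?Z2 = "rf_z \<cdot>\<^sub>m 1\<^sub>m n2 - rf_mat A2"
  show "block_diag2 A1 A2 \<in> carrier_mat (n1 + n2) (n1 + n2)"
    "block_diag2 (resolvent A1) (resolvent A2) \<in> carrier_mat (n1 + n2) (n1 + n2)"
    using A1 A2 Y1 Y2 by auto
  have Z: "?Z1 \<in> carrier_mat n1 n1" "?Z2 \<in> carrier_mat n2 n2"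
    using A1 A2 by (auto intro!: minus_carrier_mat)
  have "rf_z \<cdot>\<^sub>m 1\<^sub>m (n1 + n2) - rf_mat (block_diag2 A1 A2) = block_diag2 ?Z1 ?Z2"
    using A1 A2 by (intro eq_matI) auto
  then have "(rf_z \<cdot>\<^sub>m 1\<^sub>m (n1 + n2) - rf_mat (block_diag2 A1 A2)) *
      block_diag2 (resolvent A1) (resolvent A2) =
      block_diag2 (?Z1 * resolvent A1) (?Z2 * resolvent A2)"
    by (simp only: block_diag2_mult[OF Z Y1 Y2])
  also have "\<dots> = 1\<^sub>m (n1 + n2)"
    unfolding resolvent_right_inverse[OF A1] resolvent_right_inverse[OF A2] by simp
  finally show "(rf_z \<cdot>\<^sub>m 1\<^sub>m (n1 + n2) - rf_mat (block_diag2 A1 A2)) *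
      block_diag2 (resolvent A1) (resolvent A2) = 1\<^sub>m (n1 + n2)" .
qed

lemma transfer_matrix_block_diag2:
  assumes A: "A1 \<in> carrier_mat n1 n1" "A2 \<in> carrier_mat n2 n2"
    and B: "B1 \<in> carrier_mat n1 q1" "B2 \<in> carrier_mat n2 q2"
    and C: "C1 \<in> carrier_mat r1 n1" "C2 \<in> carrier_mat r2 n2"
  shows "transfer_matrix (block_diag2 A1 A2) (block_diag2 B1 B2) (block_diag2 C1 C2) =
    block_diag2 (transfer_matrix A1 B1 C1) (transfer_matrix A2 B2 C2)"
proof -
  note Y = resolvent_carrier[OF A(1)] resolvent_carrier[OF A(2)]
  have rfC: "rf_mat C1 \<in> carrier_mat r1 n1" "rf_mat C2 \<in> carrier_mat r2 n2"
    and rfB: "rf_mat B1 \<in> carrier_mat n1 q1" "rf_mat B2 \<in> carrier_mat n2 q2" using B C by auto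
  have CY: "rf_mat C1 * resolvent A1 \<in> carrier_mat r1 n1" "rf_mat C2 * resolvent A2 \<in> carrier_mat r2 n2"
    by (rule mult_carrier_mat[OF rfC(1) Y(1)] mult_carrier_mat[OF rfC(2) Y(2)])+
  show ?thesis
    unfolding transfer_matrix_def resolvent_block_diag2[OF A]
    unfolding rf_mat_block_diag2 block_diag2_mult[OF rfC Y] block_diag2_mult[OF CY rfB] ..
qed

lemma transfer_matrix_diag_block_mat:
  assumes "\<And>i. i \<in> set is \<Longrightarrow> A i \<in> carrier_mat (n i) (n i)"
    and "\<And>i. i \<in> set is \<Longrightarrow> B i \<in> carrier_mat (n i) (m i)"
    and "\<And>i. i \<in> set is \<Longrightarrow> C i \<in> carrier_mat (p i) (n i)"
  shows "transfer_matrix (diag_block_mat (map A is)) (diag_block_mat (map B is))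
      (diag_block_mat (map C is)) =
    diag_block_mat (map (\<lambda>i. transfer_matrix (A i) (B i) (C i)) is)"
  using assms
proof (induction "is")
  case Nil
  show ?case by (rule eq_matI) (auto simp: transfer_matrix_def)
next
  case (Cons i "is")
  then have IH: "transfer_matrix (diag_block_mat (map A is)) (diag_block_mat (map B is))
      (diag_block_mat (map C is)) =
    diag_block_mat (map (\<lambda>i. transfer_matrix (A i) (B i) (C i)) is)" by simp
  have tail: "diag_block_mat (map A is) \<in> carrier_mat (sum_list (map n is)) (sum_list (map n is))"
    "diag_block_mat (map B is) \<in> carrier_mat (sum_list (map n is)) (sum_list (map m is))"
    "diag_block_mat (map C is) \<in> carrier_mat (sum_list (map p is)) (sum_list (map n is))"
    using Cons.prems by (auto intro!: diag_block_mat_carrier)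
  show ?case
    unfolding list.map diag_block_mat_Cons IH[symmetric]
    by (rule transfer_matrix_block_diag2[OF _ tail(1) _ tail(2) _ tail(3)])
      (use Cons.prems in auto)
qed

lemma rf_mat_zero: "rf_mat (0\<^sub>m a b) = 0\<^sub>m a b"
  by (rule eq_matI) auto

lemma append_rows_eq_zero_iff:
  assumes "X \<in> carrier_mat a c" "Y \<in> carrier_mat b c"
  shows "X @\<^sub>r Y = 0\<^sub>m (a + b) c \<longleftrightarrow> X = 0\<^sub>m a c \<and> Y = 0\<^sub>m b c"
proof
  assume eq: "X @\<^sub>r Y = 0\<^sub>m (a + b) c"
  have "X $$ (i, j) = 0" if "i < a" "j < c" for i j
    using arg_cong[OF eq, of "\<lambda>M. M $$ (i, j)"] assms that by (simp add: append_rows_def)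
  moreover have "Y $$ (i, j) = 0" if "i < b" "j < c" for i j
    using arg_cong[OF eq, of "\<lambda>M. M $$ (a + i, j)"] assms that by (simp add: append_rows_def)
  ultimately show "X = 0\<^sub>m a c \<and> Y = 0\<^sub>m b c" using assms by auto
next
  assume "X = 0\<^sub>m a c \<and> Y = 0\<^sub>m b c"
  then show "X @\<^sub>r Y = 0\<^sub>m (a + b) c" by (auto simp: append_rows_def)
qed

lemma append_rows_cases:
  assumes M: "M \<in> carrier_mat (a + b) c"
  obtains X Y where "X \<in> carrier_mat a c" "Y \<in> carrier_mat b c" "M = X @\<^sub>r Y"
proof
  show "mat a c (\<lambda>(i, j). M $$ (i, j)) \<in> carrier_mat a c"
    "mat b c (\<lambda>(i, j). M $$ (a + i, j)) \<in> carrier_mat b c" by auto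
  show "M = mat a c (\<lambda>(i, j). M $$ (i, j)) @\<^sub>r mat b c (\<lambda>(i, j). M $$ (a + i, j))"
    using M by (intro eq_matI) (auto simp: append_rows_def)
qed

lemma block_diag2_mult_append_rows:
  fixes G1 G2 X Y :: "'a::semiring_0 mat"
  assumes "G1 \<in> carrier_mat a1 b1" "G2 \<in> carrier_mat a2 b2" "X \<in> carrier_mat b1 c" "Y \<in> carrier_mat b2 c"
  shows "block_diag2 G1 G2 * (X @\<^sub>r Y) = (G1 * X) @\<^sub>r (G2 * Y)"
proof -
  have "block_diag2 G1 G2 * (X @\<^sub>r Y) =
    four_block_mat (G1 * X + 0\<^sub>m a1 b2 * Y) (G1 * 0\<^sub>m b1 0 + 0\<^sub>m a1 b2 * 0\<^sub>m b2 0)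
      (0\<^sub>m a2 b1 * X + G2 * Y) (0\<^sub>m a2 b1 * 0\<^sub>m b1 0 + G2 * 0\<^sub>m b2 0)"
    using assms unfolding append_rows_def
    by (subst mult_four_block_mat[of _ a1 b1 _ b2 _ a2 _ _ c _ 0]) auto
  also have "\<dots> = (G1 * X) @\<^sub>r (G2 * Y)"
    using assms unfolding append_rows_def by (intro cong_four_block_mat) auto
  finally show ?thesis .
qed

lemma append_rows_mult:
  fixes X Y H :: "'a::semiring_0 mat"
  assumes "X \<in> carrier_mat a c" "Y \<in> carrier_mat b c" "H \<in> carrier_mat c e"
  shows "(X @\<^sub>r Y) * H = (X * H) @\<^sub>r (Y * H)"
  using assms by (intro eq_matI) (auto simp: append_rows_def row_four_block_mat[of _ a c _ 0 _ b] scalar_prod_def)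

text \<open>Splitting \<open>\<Delta>\<close> into the block rows \<open>X\<close> and \<open>Y\<close> that meet \<open>G1\<close> and \<open>G2\<close> splits \<open>G \<Delta> H\<close> into the
  block rows \<open>G1 X H\<close> and \<open>G2 Y H\<close>, which do not interact.\<close>

lemma sandwich_injective_block_diag2:
  assumes G: "G1 \<in> carrier_mat a1 b1" "G2 \<in> carrier_mat a2 b2" and H: "H \<in> carrier_mat c e"
  shows "sandwich_injective (block_diag2 G1 G2) H \<longleftrightarrow>
    sandwich_injective G1 H \<and> sandwich_injective G2 H"
proof -
  have prod: "block_diag2 G1 G2 * rf_mat (X @\<^sub>r Y) * H = (G1 * rf_mat X * H) @\<^sub>r (G2 * rf_mat Y * H)"
    if XY: "X \<in> carrier_mat b1 c" "Y \<in> carrier_mat b2 c" for X Y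
  proof -
    have "rf_mat (X @\<^sub>r Y) = rf_mat X @\<^sub>r rf_mat Y"
      using XY by (intro eq_matI)
        (auto simp: append_rows_def not_less intro!: index_map_mat(1)[symmetric])
    then have "block_diag2 G1 G2 * rf_mat (X @\<^sub>r Y) = (G1 * rf_mat X) @\<^sub>r (G2 * rf_mat Y)"
      using block_diag2_mult_append_rows[OF G, of "rf_mat X" c "rf_mat Y"] XY by simp
    then show ?thesis
      using append_rows_mult[of "G1 * rf_mat X" a1 c "G2 * rf_mat Y" a2 H e] G H XY by simp
  qed
  have zero: "block_diag2 G1 G2 * rf_mat (X @\<^sub>r Y) * H = 0\<^sub>m (a1 + a2) e \<longleftrightarrow>
      G1 * rf_mat X * H = 0\<^sub>m a1 e \<and> G2 * rf_mat Y * H = 0\<^sub>m a2 e"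
    if XY: "X \<in> carrier_mat b1 c" "Y \<in> carrier_mat b2 c" for X Y
    unfolding prod[OF that] using G H XY
    by (intro append_rows_eq_zero_iff) auto
  have "sandwich_injective (block_diag2 G1 G2) H \<longleftrightarrow> (\<forall>X \<in> carrier_mat b1 c. \<forall>Y \<in> carrier_mat b2 c.
    G1 * rf_mat X * H = 0\<^sub>m a1 e \<and> G2 * rf_mat Y * H = 0\<^sub>m a2 e \<longrightarrow> X = 0\<^sub>m b1 c \<and> Y = 0\<^sub>m b2 c)"
    (is "_ \<longleftrightarrow> ?split")
  proof
    assume L: "sandwich_injective (block_diag2 G1 G2) H"
    show ?split
    proof (intro ballI impI)
      fix X Y assume XY: "X \<in> carrier_mat b1 c" "Y \<in> carrier_mat b2 c"
        "G1 * rf_mat X * H = 0\<^sub>m a1 e \<and> G2 * rf_mat Y * H = 0\<^sub>m a2 e"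
      have "X @\<^sub>r Y = 0\<^sub>m (b1 + b2) c"
        using L zero[OF XY(1,2)] XY G H carrier_append_rows[OF XY(1,2)]
        unfolding sandwich_injective_def by auto
      then show "X = 0\<^sub>m b1 c \<and> Y = 0\<^sub>m b2 c" using append_rows_eq_zero_iff[OF XY(1,2)] by simp
    qed
  next
    assume R: ?split
    show "sandwich_injective (block_diag2 G1 G2) H"
      unfolding sandwich_injective_def
    proof (intro ballI impI)
      fix \<Delta> assume \<Delta>: "\<Delta> \<in> carrier_mat (dim_col (block_diag2 G1 G2)) (dim_row H)"
        and z: "block_diag2 G1 G2 * rf_mat \<Delta> * H = 0\<^sub>m (dim_row (block_diag2 G1 G2)) (dim_col H)"
      have "\<Delta> \<in> carrier_mat (b1 + b2) c" using \<Delta> G H by simp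
      then obtain X Y where XY: "X \<in> carrier_mat b1 c" "Y \<in> carrier_mat b2 c" and \<Delta>: "\<Delta> = X @\<^sub>r Y"
        by (rule append_rows_cases)
      have "block_diag2 G1 G2 * rf_mat (X @\<^sub>r Y) * H = 0\<^sub>m (a1 + a2) e" using z G H \<Delta> by simp
      then have "X = 0\<^sub>m b1 c \<and> Y = 0\<^sub>m b2 c" using R XY unfolding zero[OF XY] by blast
      then show "\<Delta> = 0\<^sub>m (dim_col (block_diag2 G1 G2)) (dim_row H)"
        using append_rows_eq_zero_iff[OF XY] \<Delta> G H by simp
    qed
  qed
  also have "\<dots> \<longleftrightarrow> sandwich_injective G1 H \<and> sandwich_injective G2 H"
  proof -
    have dims: "dim_row G1 = a1" "dim_col G1 = b1" "dim_row G2 = a2" "dim_col G2 = b2"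
      "dim_row H = c" "dim_col H = e" using G H by auto
    have "G1 * rf_mat (0\<^sub>m b1 c) * H = 0\<^sub>m a1 e" "G2 * rf_mat (0\<^sub>m b2 c) * H = 0\<^sub>m a2 e"
      using G H by (simp_all add: rf_mat_zero)
    then show ?thesis
      unfolding sandwich_injective_def dims by (meson zero_carrier_mat)
  qed
  finally show ?thesis .
qed

lemma sandwich_injective_diag_block_mat:
  assumes "\<And>i. i \<in> set is \<Longrightarrow> G i \<in> carrier_mat (p i) (m i)" and H: "H \<in> carrier_mat c e"
  shows "sandwich_injective (diag_block_mat (map G is)) H \<longleftrightarrow> (\<forall>i \<in> set is. sandwich_injective (G i) H)"
  using assms(1)
proof (induction "is")
  case Nil
  show ?case by (auto simp: sandwich_injective_def)
next
  case (Cons i "is")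
  have "G i \<in> carrier_mat (p i) (m i)"
    "diag_block_mat (map G is) \<in> carrier_mat (sum_list (map p is)) (sum_list (map m is))"
    using Cons.prems by (auto intro!: diag_block_mat_carrier)
  then show ?case
    unfolding list.map diag_block_mat_Cons
    using sandwich_injective_block_diag2[OF _ _ H] Cons by (simp del: four_block_carrier_mat)
qed

section \<open>The Kronecker product\<close>

text \<open>The matrix \<open>\<Delta>\<close> is filled row by row from \<open>w\<close>, because the second Kronecker factor has the fast-running
  index; \<open>(G \<otimes> H\<^sup>T) w\<close> then lists the entries of \<open>G \<Delta> H\<close> in the same order.\<close>

lemma kronecker_transpose_mult_vec:
  fixes w :: "real vec"
  assumes G: "G \<in> carrier_mat r k" and H: "H \<in> carrier_mat c e" and w: "w \<in> carrier_vec (k * c)"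
    and x: "x < r * e"
  defines "\<Delta> \<equiv> mat k c (\<lambda>(a, b). w $ (a * c + b))"
  shows "((G \<otimes>\<^sub>K transpose_mat H) *\<^sub>v map_vec rf_const w) $ x =
    (G * rf_mat \<Delta> * H) $$ (x div e, x mod e)"
proof -
  have e: "e > 0" using x by (cases e) auto
  have xr: "x div e < r" using x by (simp add: less_mult_imp_div_less)
  have xe: "x mod e < e" using e by simp
  have mod_c: "y mod c < c" if "y < k * c" for y
    using that by (cases "c = 0") auto
  have "((G \<otimes>\<^sub>K transpose_mat H) *\<^sub>v map_vec rf_const w) $ x =
     (\<Sum>y < k * c. G $$ (x div e, y div c) * H $$ (y mod c, x mod e) * rf_const (w $ y))"
    using G H w x xr xe mod_c
    by (auto simp: kronecker_def scalar_prod_def lessThan_atLeast0 less_mult_imp_div_less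
        intro!: sum.cong)
  also have "\<dots> = (\<Sum>a<k. \<Sum>y = a * c..<a * c + c.
      G $$ (x div e, y div c) * H $$ (y mod c, x mod e) * rf_const (w $ y))"
    by (rule sum.nat_group[symmetric])
  also have "\<dots> = (\<Sum>a<k. \<Sum>b<c. G $$ (x div e, a) * H $$ (b, x mod e) * rf_const (w $ (a * c + b)))"
    by (subst sum.atLeastLessThan_shift_0) (simp add: lessThan_atLeast0)
  also have "\<dots> = (\<Sum>b<c. \<Sum>a<k. G $$ (x div e, a) * H $$ (b, x mod e) * rf_const (w $ (a * c + b)))"
    by (rule sum.swap)
  also have "\<dots> = (\<Sum>b<c. (\<Sum>a<k. G $$ (x div e, a) * rf_const (\<Delta> $$ (a, b))) * H $$ (b, x mod e))"
    by (auto simp: sum_distrib_right \<Delta>_def intro!: sum.cong)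
  also have "\<dots> = (G * rf_mat \<Delta> * H) $$ (x div e, x mod e)"
    using G H xr xe by (auto simp: \<Delta>_def scalar_prod_def lessThan_atLeast0 intro!: sum.cong)
  finally show ?thesis .
qed

text \<open>Filling matrices row by row is a linear bijection between vectors and matrices that takes the constant
  kernel to the kernel of \<open>\<Delta> \<mapsto> G \<Delta> H\<close>.\<close>

lemma cker_kronecker_trivial_iff:
  assumes G: "G \<in> carrier_mat r k" and H: "H \<in> carrier_mat c e"
  shows "cker (G \<otimes>\<^sub>K transpose_mat H) = {0\<^sub>v (k * c)} \<longleftrightarrow> sandwich_injective G H"
proof -
  let ?K = "G \<otimes>\<^sub>K transpose_mat H"
  let ?\<Delta> = "\<lambda>w :: real vec. mat k c (\<lambda>(a, b). w $ (a * c + b))"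
  have dims: "dim_row ?K = r * e" "dim_col ?K = k * c" using G H by (auto simp: kronecker_def)
  have idx: "a * d + b < l * d" if "a < l" "b < d" for a b l d :: nat
  proof -
    have "a * d + b < Suc a * d" using that by simp
    also have "\<dots> \<le> l * d" using that by (intro mult_le_mono1) simp
    finally show ?thesis .
  qed
  have ker: "w \<in> cker ?K \<longleftrightarrow> G * rf_mat (?\<Delta> w) * H = 0\<^sub>m r e"
    if w: "w \<in> carrier_vec (k * c)" for w
  proof -
    have "w \<in> cker ?K \<longleftrightarrow> (\<forall>x < r * e. (?K *\<^sub>v map_vec rf_const w) $ x = 0)"
      using w dims unfolding cker_def by (auto simp: vec_eq_iff simp del: index_mult_mat_vec)
    also have "\<dots> \<longleftrightarrow> (\<forall>x < r * e. (G * rf_mat (?\<Delta> w) * H) $$ (x div e, x mod e) = 0)"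
      using kronecker_transpose_mult_vec[OF G H w] by simp
    also have "\<dots> \<longleftrightarrow> (\<forall>i < r. \<forall>j < e. (G * rf_mat (?\<Delta> w) * H) $$ (i, j) = 0)" (is "?l \<longleftrightarrow> ?r")
    proof
      assume L: ?l
      show ?r
      proof (intro allI impI)
        fix i j assume ij: "i < r" "j < e"
        then have "(i * e + j) div e = i" "(i * e + j) mod e = j" by auto
        then show "(G * rf_mat (?\<Delta> w) * H) $$ (i, j) = 0" using L idx[OF ij] by metis
      qed
    next
      assume R: ?r
      show ?l
      proof (intro allI impI)
        fix x assume x: "x < r * e"
        then have "e > 0" by (cases e) auto
        then have "x div e < r" "x mod e < e" using x by (auto simp: less_mult_imp_div_less)
        then show "(G * rf_mat (?\<Delta> w) * H) $$ (x div e, x mod e) = 0" using R by blast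
      qed
    qed
    also have "\<dots> \<longleftrightarrow> G * rf_mat (?\<Delta> w) * H = 0\<^sub>m r e"
      using G H by (auto simp: mat_eq_iff simp del: index_mult_mat(1))
    finally show ?thesis .
  qed
  have \<Delta>0: "?\<Delta> w = 0\<^sub>m k c \<longleftrightarrow> w = 0\<^sub>v (k * c)" if w: "w \<in> carrier_vec (k * c)" for w
  proof
    assume eq: "?\<Delta> w = 0\<^sub>m k c"
    have "w $ y = 0" if y: "y < k * c" for y
    proof -
      have "c > 0" using y by (cases c) auto
      then have "y div c < k" "y mod c < c" using y by (auto simp: less_mult_imp_div_less)
      then show ?thesis
        using arg_cong[OF eq, of "\<lambda>M. M $$ (y div c, y mod c)"] by simp
    qed
    then show "w = 0\<^sub>v (k * c)" using w by auto
  qed (auto simp: idx intro!: eq_matI)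
  have surj: "\<exists>w \<in> carrier_vec (k * c). ?\<Delta> w = X" if X: "X \<in> carrier_mat k c" for X
  proof
    show "vec (k * c) (\<lambda>y. X $$ (y div c, y mod c)) \<in> carrier_vec (k * c)" by simp
    show "?\<Delta> (vec (k * c) (\<lambda>y. X $$ (y div c, y mod c))) = X"
      using X by (intro eq_matI) (auto simp: idx)
  qed
  have zero: "0\<^sub>v (k * c) \<in> cker ?K"
    using dims mult_mat_zero_vec[of ?K "r * e" "k * c"]
    unfolding cker_def by (auto simp: rf_const.vec_hom_zero)
  have sub: "cker ?K \<subseteq> carrier_vec (k * c)" using dims unfolding cker_def by auto
  have dims': "dim_row G = r" "dim_col G = k" "dim_row H = c" "dim_col H = e" using G H by auto
  have "cker ?K = {0\<^sub>v (k * c)} \<longleftrightarrow> (\<forall>w \<in> carrier_vec (k * c). w \<in> cker ?K \<longrightarrow> w = 0\<^sub>v (k * c))"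
    using zero sub by blast
  also have "\<dots> \<longleftrightarrow> (\<forall>w \<in> carrier_vec (k * c). G * rf_mat (?\<Delta> w) * H = 0\<^sub>m r e \<longrightarrow> ?\<Delta> w = 0\<^sub>m k c)"
    using ker \<Delta>0 by blast
  also have "\<dots> \<longleftrightarrow> (\<forall>X \<in> carrier_mat k c. G * rf_mat X * H = 0\<^sub>m r e \<longrightarrow> X = 0\<^sub>m k c)"
    using surj by (metis mat_carrier)
  finally show ?thesis unfolding sandwich_injective_def dims' .
qed

section \<open>Dimensions of the block matrices\<close>

lemma append_cols_carrier:
  "X \<in> carrier_mat r c1 \<Longrightarrow> Y \<in> carrier_mat r c2 \<Longrightarrow> append_cols X Y \<in> carrier_mat r (c1 + c2)"
  unfolding append_cols_def by auto

lemma foldr_append_cols_carrier: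
  assumes "\<And>i. i \<in> set is \<Longrightarrow> X i \<in> carrier_mat r (c i)"
  shows "foldr append_cols (map X is) (0\<^sub>m r 0) \<in> carrier_mat r (sum_list (map c is))"
  using assms
proof (induction "is")
  case (Cons i "is")
  then have "X i \<in> carrier_mat r (c i)"
    "foldr append_cols (map X is) (0\<^sub>m r 0) \<in> carrier_mat r (sum_list (map c is))" by auto
  then show ?case by (auto intro!: append_cols_carrier)
qed simp

lemma foldr_append_rows_carrier:
  assumes "\<And>i. i \<in> set is \<Longrightarrow> X i \<in> carrier_mat (r i) c"
  shows "foldr append_rows (map X is) (0\<^sub>m 0 c) \<in> carrier_mat (sum_list (map r is)) c"
  using assms
proof (induction "is")
  case (Cons i "is")
  then have "X i \<in> carrier_mat (r i) c"
    "foldr append_rows (map X is) (0\<^sub>m 0 c) \<in> carrier_mat (sum_list (map r is)) c" by auto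
  then show ?case by auto
qed simp

lemma sum_list_nodes: "sum_list (map f [1..<Suc N]) = (\<Sum>j = 1..N. f j)"
  by (simp only: interv_sum_list_conv_sum_set_nat set_upt atLeastLessThanSuc_atLeastAtMost)

lemma set_nodes: "set [1..<Suc N] = {1..N}"
  by (simp only: set_upt atLeastLessThanSuc_atLeastAtMost)

lemma block_diag_carrier:
  assumes "\<And>i. i \<in> {1..N} \<Longrightarrow> X i \<in> carrier_mat (r i) (c i)"
  shows "block_diag N X \<in> carrier_mat (\<Sum>i = 1..N. r i) (\<Sum>i = 1..N. c i)"
  unfolding block_diag_def sum_list_nodes[symmetric]
  by (rule diag_block_mat_carrier) (unfold set_nodes, rule assms)

lemma block_row_carrier:
  assumes "\<And>i. i \<in> {1..N} \<Longrightarrow> X i \<in> carrier_mat r (c i)"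
  shows "block_row r N X \<in> carrier_mat r (\<Sum>i = 1..N. c i)"
  unfolding block_row_def sum_list_nodes[symmetric]
  by (rule foldr_append_cols_carrier) (unfold set_nodes, rule assms)

lemma block_col_carrier:
  assumes "\<And>i. i \<in> {1..N} \<Longrightarrow> X i \<in> carrier_mat (r i) c"
  shows "block_col c N X \<in> carrier_mat (\<Sum>i = 1..N. r i) c"
  unfolding block_col_def sum_list_nodes[symmetric]
  by (rule foldr_append_rows_carrier) (unfold set_nodes, rule assms)

lemma block_matrix_carrier:
  assumes "\<And>i j. i \<in> {1..N} \<Longrightarrow> j \<in> {1..N} \<Longrightarrow> X i j \<in> carrier_mat (r i) (c j)"
  shows "block_matrix r c N X \<in> carrier_mat (\<Sum>i = 1..N. r i) (\<Sum>j = 1..N. c j)"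
  unfolding block_matrix_def using assms by (intro block_col_carrier block_row_carrier) auto

section \<open>Identifiability of the topology\<close>

theorem theorem2:
  fixes N :: nat
    and n m p :: "nat \<Rightarrow> nat"
    and m_ext p_ext :: nat
    and A_node B_node C_node R_node S_node :: "nat \<Rightarrow> real mat"
    and Q_block :: "nat \<Rightarrow> nat \<Rightarrow> real mat"
    and A B C Q R S :: "real mat"
  assumes "N \<ge> 1"
    and "\<And>i. i \<in> {1..N} \<Longrightarrow> A_node i \<in> carrier_mat (n i) (n i)"
    and "\<And>i. i \<in> {1..N} \<Longrightarrow> B_node i \<in> carrier_mat (n i) (m i)"
    and "\<And>i. i \<in> {1..N} \<Longrightarrow> C_node i \<in> carrier_mat (p i) (n i)"
    and "\<And>i j. i \<in> {1..N} \<Longrightarrow> j \<in> {1..N} \<Longrightarrow> Q_block i j \<in> carrier_mat (m i) (p j)"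
    and "\<And>i. i \<in> {1..N} \<Longrightarrow> R_node i \<in> carrier_mat (m i) m_ext"
    and "\<And>i. i \<in> {1..N} \<Longrightarrow> S_node i \<in> carrier_mat p_ext (p i)"
    and "A = block_diag N A_node"
    and "B = block_diag N B_node"
    and "C = block_diag N C_node"
    and "Q = block_matrix m p N Q_block"
    and "R = block_col m_ext N R_node"
    and "S = block_row p_ext N S_node"
    and "full_column_rank S"
  shows "topology_identifiable A B C R S Q \<longleftrightarrow>
    (\<forall>i \<in> {1..N}.
      cker (transfer_matrix (A_node i) (B_node i) (C_node i) \<otimes>\<^sub>K
        transpose_mat (network_H A B C R Q))
      = {0\<^sub>v (m i * (\<Sum>j = 1..N. p j))})"
proof -
  let ?n = "\<Sum>i = 1..N. n i" and ?m = "\<Sum>i = 1..N. m i" and ?p = "\<Sum>i = 1..N. p i"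
  let ?G = "\<lambda>i. transfer_matrix (A_node i) (B_node i) (C_node i)"
  let ?H = "network_H A B C R Q"
  have A: "A \<in> carrier_mat ?n ?n" and B: "B \<in> carrier_mat ?n ?m" and C: "C \<in> carrier_mat ?p ?n"
    unfolding assms(8-10) by (rule block_diag_carrier, rule assms, assumption)+
  have Q: "Q \<in> carrier_mat ?m ?p" and R: "R \<in> carrier_mat ?m m_ext" and S: "S \<in> carrier_mat p_ext ?p"
    unfolding assms(11-13)
    by (rule block_matrix_carrier block_col_carrier block_row_carrier, rule assms, assumption+)+
  have G: "?G i \<in> carrier_mat (p i) (m i)" if "i \<in> {1..N}" for i
    using assms that by (intro transfer_matrix_carrier) auto
  have H: "?H \<in> carrier_mat ?p m_ext"
    unfolding network_H_eq_transfer_matrix[OF A B C Q R]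
    using A B C Q R by (intro transfer_matrix_carrier[of _ ?n]) auto
  have "transfer_matrix A B C = diag_block_mat (map ?G [1..<Suc N])"
    unfolding assms(8-10) block_diag_def
    by (rule transfer_matrix_diag_block_mat[of _ _ n _ m _ p]) (unfold set_nodes, (rule assms, assumption)+)
  then have "topology_identifiable A B C R S Q \<longleftrightarrow> (\<forall>i \<in> {1..N}. sandwich_injective (?G i) ?H)"
    using topology_identifiable_iff_sandwich_injective[OF A B C Q R S assms(14)]
      sandwich_injective_diag_block_mat[OF _ H, of "[1..<Suc N]" ?G p m] G unfolding set_nodes by simp
  also have "\<dots> \<longleftrightarrow> (\<forall>i \<in> {1..N}. cker (?G i \<otimes>\<^sub>K transpose_mat ?H) = {0\<^sub>v (m i * ?p)})"
    using cker_kronecker_trivial_iff[OF G H] by simp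
  finally show ?thesis .
qed

end
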